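(* Let $\lambda$ be a random element of $\mathcal W^N_{\mathbb Z}$ whose Schur generating function $S$ is defined on $\Omega^N$ for a domain $\Omega\ni0$, and let $\widetilde S$ be a supersymmetric lift of $S$ on $\Omega$. Then for $c_1,\dots,c_k\in\mathbb C$, $$\mathbb E\Big[\prod_{i=1}^k\sum_{j=1}^Ne^{c_i(\lambda_j+N-j)}\Big]=\frac1{(2\pi\mathrm i)^k}\oint\!\cdots\!\oint\widetilde S(u_1+c_1,\dots,u_k+c_k,0^N/u_1,\dots,u_k)\prod_{1\le i<j\le k}\frac{(e^{u_j+c_j}-e^{u_i+c_i})(e^{u_j}-e^{u_i})}{(e^{u_j}-e^{u_i+c_i})(e^{u_j+c_j}-e^{u_i})}\prod_{i=1}^k\Big(\frac{e^{u_i+c_i}-1}{e^{u_i}-1}\Big)^N\frac{du_i}{e^{c_i}-1},$$ where for each $i$ both the $u_i$-contour and its translate by $c_i$ lie in $\Omega$ and are positively oriented around $0$, and the $u_j$-contour contains $u_i+c_i$ whenever $i<j$, provided such contours exist.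
   Context: $\mathcal W^N_{\mathbb Z}=\{\lambda\in\mathbb Z^N:\lambda_1\ge\dots\ge\lambda_N\}$. The rational Schur function is $s_\lambda(z_1,\dots,z_N)=\det(z_i^{\lambda_j+N-j})/\prod_{i<j}(z_i-z_j)$. The Schur generating function of a random $\lambda$ is $S(z_1,\dots,z_N)=\mathbb E[s_\lambda(e^{z_1},\dots,e^{z_N})/s_\lambda(1,\dots,1)]$, assumed absolutely convergent uniformly near $0$. For an analytic symmetric $S$ on $\Omega^N$, a supersymmetric lift of $S$ on $\Omega$ is a family $\{\widetilde S_k\}_{k\ge0}$ with $\widetilde S_k(x_1,\dots,x_{N+k}/y_1,\dots,y_k)$ analytic on $\Omega^{N+k}\times\Omega^k$, symmetric in the $x$'s and separately in the $y$'s, with $\widetilde S_0=S$ and $\widetilde S_k|_{x_{N+k}=y_k}=\widetilde S_{k-1}(x_1,\dots,x_{N+k-1}/y_1,\dots,y_{k-1})$. Notation $0^N$ means $N$ arguments equal to $0$.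
   Formalization: Also assumed: e^{c_i}≠1; contours and translates are simple closed with interiors in Ω; the u_i-contour encloses no 2πim (m≠0), the u_j-contour no u_i+c_i+2πim (m≠0, i<j); contours avoid all zeros of the integrand's denominators. Otherwise it is undefined or gains extra residues. *)

theory Defs
  imports "HOL-Complex_Analysis.Complex_Analysis" "HOL-Probability.Probability"
          "HOL-Combinatorics.Permutations"
begin

text \<open>Lists of length N are used for points of C^N and for signatures lambda
  (index 0 corresponds to lambda_1). The determinant det(x_i^(lambda_j+N-j)) is written
  via the Leibniz formula; exponents are integers (lambda may have negative parts).\<close>

definition schur_det :: "int list \<Rightarrow> complex list \<Rightarrow> complex" where
  "schur_det l x = (let n = length x in
     (\<Sum>\<sigma> | \<sigma> permutes {..<n}. of_int (sign \<sigma>) *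
        (\<Prod>i<n. (x ! i) powi (l ! (\<sigma> i) + int n - 1 - int (\<sigma> i)))))"

definition vandermonde :: "complex list \<Rightarrow> complex" where
  "vandermonde x = (let n = length x in \<Prod>i<n. \<Prod>j\<in>{i<..<n}. (x ! i - x ! j))"

text \<open>The rational Schur function (meaningful at points with pairwise distinct coordinates).\<close>
definition schur :: "int list \<Rightarrow> complex list \<Rightarrow> complex" where
  "schur l x = schur_det l x / vandermonde x"

text \<open>Value s_lambda(1,...,1), obtained by continuity of the (Laurent polynomial)
  Schur function: limit of s_lambda(q^(N-1),...,q,1) as q tends to 1.\<close>
definition schur_one :: "nat \<Rightarrow> int list \<Rightarrow> complex" where
  "schur_one N l = Lim (at (1::complex)) (\<lambda>q. schur l (map (\<lambda>i. q ^ (N - 1 - i)) [0..<N]))"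

definition schur_ratio :: "nat \<Rightarrow> int list \<Rightarrow> complex list \<Rightarrow> complex" where
  "schur_ratio N l z = schur l (map exp z) / schur_one N l"

definition signatures :: "nat \<Rightarrow> int list set" where
  "signatures N = {l. length l = N \<and> sorted_wrt (\<ge>) l}"

definition points :: "complex set \<Rightarrow> nat \<Rightarrow> complex list set" where
  "points A n = {z. length z = n \<and> set z \<subseteq> A}"

definition exp_distinct :: "complex list \<Rightarrow> bool" where
  "exp_distinct z = distinct (map exp z)"

text \<open>Holomorphic in several variables: continuous and holomorphic in each variable
  separately (Osgood's lemma).\<close>
definition analytic_lists :: "complex set \<Rightarrow> nat \<Rightarrow> (complex list \<Rightarrow> complex) \<Rightarrow> bool" where
  "analytic_lists A n f \<longleftrightarrow>
     (\<forall>z\<in>points A n. \<forall>i<n. (\<lambda>t. f (z[i := t])) holomorphic_on A) \<and>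
     (\<forall>z w. z \<in> points A n \<longrightarrow> (\<forall>j. w j \<in> points A n) \<longrightarrow>
        (\<forall>i<n. (\<lambda>j. w j ! i) \<longlonglongrightarrow> z ! i) \<longrightarrow> (\<lambda>j. f (w j)) \<longlonglongrightarrow> f z)"

definition symmetric_on :: "complex set \<Rightarrow> nat \<Rightarrow> (complex list \<Rightarrow> complex) \<Rightarrow> bool" where
  "symmetric_on A n f \<longleftrightarrow>
     (\<forall>z z'. z \<in> points A n \<longrightarrow> mset z' = mset z \<longrightarrow> f z' = f z)"

definition supersymmetric_lift ::
  "complex set \<Rightarrow> nat \<Rightarrow> (complex list \<Rightarrow> complex) \<Rightarrow>
   (nat \<Rightarrow> complex list \<Rightarrow> complex list \<Rightarrow> complex) \<Rightarrow> bool" where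
  "supersymmetric_lift A N S St \<longleftrightarrow>
     (\<forall>k. analytic_lists A (N + k + k) (\<lambda>v. St k (take (N + k) v) (drop (N + k) v))) \<and>
     (\<forall>k x x' y. x \<in> points A (N + k) \<longrightarrow> y \<in> points A k \<longrightarrow> mset x' = mset x \<longrightarrow>
        St k x' y = St k x y) \<and>
     (\<forall>k x y y'. x \<in> points A (N + k) \<longrightarrow> y \<in> points A k \<longrightarrow> mset y' = mset y \<longrightarrow>
        St k x y' = St k x y) \<and>
     (\<forall>x\<in>points A N. St 0 x [] = S x) \<and>
     (\<forall>k x y. x \<in> points A (N + Suc k) \<longrightarrow> y \<in> points A (Suc k) \<longrightarrow> last x = last y \<longrightarrow>
        St (Suc k) x y = St k (butlast x) (butlast y))"

definition pos_contour_around0 :: "complex set \<Rightarrow> (real \<Rightarrow> complex) \<Rightarrow> bool" where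
  "pos_contour_around0 A g \<longleftrightarrow>
     valid_path g \<and> simple_path g \<and> pathfinish g = pathstart g \<and>
     path_image g \<subseteq> A \<and> 0 \<notin> path_image g \<and> winding_number g 0 = 1 \<and>
     (\<forall>z. z \<notin> path_image g \<longrightarrow> winding_number g z \<noteq> 0 \<longrightarrow> z \<in> A)"

fun icint :: "(nat \<Rightarrow> real \<Rightarrow> complex) \<Rightarrow> nat \<Rightarrow> ((nat \<Rightarrow> complex) \<Rightarrow> complex) \<Rightarrow>
              (nat \<Rightarrow> complex) \<Rightarrow> complex" where
  "icint g 0 F u = F u"
| "icint g (Suc n) F u = contour_integral (g n) (\<lambda>t. icint g n F (u(n := t)))"

end

theory Submission
  imports Defs "HOL-Analysis.Function_Metric" "Jordan_Normal_Form.Determinant"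
begin

text \<open>
  On functions of N variables let D_a be the difference operator
  V^(-1) (\<Sum>j T_(a,j)) V, where V is the Vandermonde product in the exp z_i and T_(a,j)
  translates z_j by a. Expanding the determinant shows that a Schur function is an eigenfunction
  of D_a with eigenvalue \<Sum>j exp (a (\<lambda>_j + N - j)), so applying D_(c_1), ..., D_(c_k) under the
  expectation produces the moment times the normalised Schur function.

  On the other side, replace 0^N in the contour integral by a point z with distinct exponentials.
  Integrating over the innermost variable u_1 picks up the simple poles u_1 = z_j only: the nesting
  of the contours and the fact that no compact set lies inside a translate of itself exclude all other
  poles. By the cancellation property of the lift, the residue at z_j is the corresponding term of
  D_(c_1) applied to the (k-1)-fold integral, and induction gives D_(c_k) ... D_(c_1) S(z).

  Finally z tends to 0 along z_i = e ((N - 1) / 2 - i). There the normalised Schur function is a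
  product of quotients sinh (e a) b / (sinh (e b) a) with a \<ge> b, hence at least 1 and essentially
  increasing in e, which yields integrability and dominated convergence.
\<close>

section \<open>Contour integrals depending on parameters\<close>

text \<open>Three obstacles shape the proof. At 0^N the innermost integrand has a pole of order N at
  0; a point with distinct exponentials splits it into N simple poles, but then both sides must be
  carried back to 0^N. Next, the expectation formula for \<open>S\<close> is available only at
  points of \<open>\<Omega>\<close>^N with distinct exponentials, so every point reached by
  successive translations has to be of this kind; \<open>shift_all\<close> records it. Finally, all
  denominators are 2 pi i-periodic whereas \<open>\<Omega>\<close> and the contours live in the
  plane. Each pole therefore comes with a lattice of copies, which must be shown to lie outside the
  contours; the period conditions and the lemmas on translated curves serve this purpose. The
  symmetric choice (N - 1) / 2 - i has a reason too: at exp (e (b - i)) a Schur function carries the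
  factor exp (e (b - (N - 1) / 2) |lambda|), with |lambda| the sum of the parts, and this has no
  positive lower bound in lambda unless b = (N - 1) / 2.\<close>

text \<open>A valid path may fail to be rectifiable, since its derivative may be unbounded at the break points;
  integrals of merely continuous functions along it need not exist. For holomorphic integrands it can be
  replaced by a nearby polynomial path.\<close>

lemma contour_integral_polynomial_path:
  assumes "open S" "valid_path g" "path_image g \<subseteq> S"
  obtains h where "polynomial_function h" "path_image h \<subseteq> S"
    "\<And>f. f holomorphic_on S \<Longrightarrow> contour_integral g f = contour_integral h f"
proof -
  have pg: "path g" using assms(2) valid_path_imp_path by blast
  obtain d where d: "d > 0" and near: "\<And>g1 g2. \<lbrakk>valid_path g1; valid_path g2;
      \<forall>t\<in>{0..1}. norm (g1 t - g t) < d \<and> norm (g2 t - g t) < d;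
      pathstart g2 = pathstart g1 \<and> pathfinish g2 = pathfinish g1\<rbrakk> \<Longrightarrow>
      path_image g1 \<subseteq> S \<and> path_image g2 \<subseteq> S \<and>
      (\<forall>f. f holomorphic_on S \<longrightarrow> contour_integral g2 f = contour_integral g1 f)"
    using contour_integral_nearby_ends[OF assms(1) pg assms(3)] by metis
  obtain h where h: "polynomial_function h" "pathstart h = pathstart g" "pathfinish h = pathfinish g"
    "\<And>t. t \<in> {0..1} \<Longrightarrow> norm (h t - g t) < d"
    using path_approx_polynomial_function[OF pg d] by blast
  have vh: "valid_path h" by (rule valid_path_polynomial_function[OF h(1)])
  show thesis
    using near[OF vh assms(2)] h d by (intro that[of h]) auto
qed

text \<open>One polynomial path replaces \<open>g\<close> for every \<open>x\<close> at once. Its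
  derivative is continuous, so the integral becomes an ordinary parameter integral over [0, 1] with
  jointly continuous integrand; holomorphy of \<open>F x\<close> serves the replacement of the
  path.\<close>

lemma continuous_on_contour_integral_param:
  fixes F :: "'a::topological_space \<Rightarrow> complex \<Rightarrow> complex"
  assumes "continuous_on (P \<times> U) (\<lambda>(x, t). F x t)" "open U" "valid_path g" "path_image g \<subseteq> U"
    and "\<And>x. x \<in> P \<Longrightarrow> F x holomorphic_on U"
  shows "continuous_on P (\<lambda>x. contour_integral g (F x))"
proof -
  obtain h where h: "polynomial_function h" "path_image h \<subseteq> U"
    "\<And>f. f holomorphic_on U \<Longrightarrow> contour_integral g f = contour_integral h f"
    using contour_integral_polynomial_path[OF assms(2-4)] by blast
  obtain h' where h': "polynomial_function h'" "\<And>x. (h has_vector_derivative h' x) (at x)"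
    using has_vector_derivative_polynomial_function[OF h(1)] by blast
  have vd: "vector_derivative h (at x) = h' x" for x
    using h'(2) vector_derivative_at by blast
  have ch: "continuous_on A h" "continuous_on A h'" for A
    using h(1) h'(1) continuous_on_polymonial_function by blast+
  have eq: "contour_integral g (F x) = integral (cbox 0 1) (\<lambda>t. F x (h t) * h' t)" if "x \<in> P" for x
    using h(3)[OF assms(5)[OF that]] by (simp add: contour_integral_integral vd cbox_interval)
  have sub: "h t \<in> U" if "t \<in> {0..1}" for t
    using h(2) that by (auto simp: path_image_def)
  have "continuous_on (P \<times> cbox 0 1) (\<lambda>y. (\<lambda>(x,t). F x t) (fst y, h (snd y)) * h' (snd y))"
    using sub
    by (intro continuous_intros continuous_on_compose2[OF assms(1)]
          continuous_on_compose2[OF ch(1)] continuous_on_compose2[OF ch(2)]) (auto simp: cbox_interval)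
  then have "continuous_on P (\<lambda>x. integral (cbox 0 1) (\<lambda>t. F x (h t) * h' t))"
    by (intro integral_continuous_on_param) (simp add: case_prod_unfold)
  then show ?thesis
    by (subst continuous_on_cong[OF refl eq]) auto
qed

text \<open>Morera's theorem: the integral over a triangle in \<open>V\<close> is interchanged with
  the one along the polynomial path, and the inner triangle integral vanishes by Cauchy's theorem
  because \<open>F\<close> is holomorphic in \<open>x\<close>.\<close>

lemma holomorphic_on_contour_integral_param:
  fixes F :: "complex \<Rightarrow> complex \<Rightarrow> complex"
  assumes cont: "continuous_on (V \<times> U) (\<lambda>(x, t). F x t)" and "open U" "open V"
    and "valid_path g" "path_image g \<subseteq> U"
    and hol: "\<And>x. x \<in> V \<Longrightarrow> F x holomorphic_on U"
    and hol': "\<And>t. t \<in> U \<Longrightarrow> (\<lambda>x. F x t) holomorphic_on V"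
  shows "(\<lambda>x. contour_integral g (F x)) holomorphic_on V"
proof -
  obtain h where h: "polynomial_function h" "path_image h \<subseteq> U"
    "\<And>f. f holomorphic_on U \<Longrightarrow> contour_integral g f = contour_integral h f"
    using contour_integral_polynomial_path[OF assms(2,4,5)] by blast
  obtain h' where h': "polynomial_function h'" "\<And>x. (h has_vector_derivative h' x) (at x)"
    using has_vector_derivative_polynomial_function[OF h(1)] by blast
  have vd: "vector_derivative h (at x) = h' x" for x
    using h'(2) vector_derivative_at by blast
  have ch: "continuous_on A h'" for A
    using h'(1) continuous_on_polymonial_function by blast
  have vh: "valid_path h" by (rule valid_path_polynomial_function[OF h(1)])
  have contF: "continuous_on V (\<lambda>x. contour_integral h (F x))"
    by (rule continuous_on_contour_integral_param[OF cont assms(2) vh h(2) hol])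
  have "(\<lambda>x. contour_integral h (F x)) analytic_on V"
  proof (rule Morera_triangle[OF contF \<open>open V\<close>], intro impI)
    fix a b c assume tri: "convex hull {a, b, c} \<subseteq> V"
    have seg: "closed_segment a b \<subseteq> V" "closed_segment b c \<subseteq> V" "closed_segment c a \<subseteq> V"
      by (auto intro!: order_trans[OF _ tri] segments_subset_convex_hull)
    have sw: "contour_integral (linepath x y) (\<lambda>w. contour_integral h (F w)) =
         contour_integral h (\<lambda>t. contour_integral (linepath x y) (\<lambda>w. F w t))"
      if "closed_segment x y \<subseteq> V" for x y
      by (rule contour_integral_swap)
         (use that h(2) vh ch in \<open>auto simp: vd intro!: continuous_on_subset[OF cont]\<close>)
    \<comment> \<open>Continuity in \<open>t\<close> suffices for integrability along the polynomial
      path; it is needed to combine the three sides of the triangle.\<close>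
    have int: "(\<lambda>t. contour_integral (linepath x y) (\<lambda>w. F w t)) contour_integrable_on h"
      if "closed_segment x y \<subseteq> V" for x y
    proof -
      have "continuous_on (path_image h \<times> V) ((\<lambda>(x, t). F x t) \<circ> prod.swap)"
        using h(2) by (intro continuous_on_compose continuous_on_subset[OF cont] continuous_on_swap) auto
      then have "continuous_on (path_image h) (\<lambda>t. contour_integral (linepath x y) (\<lambda>w. F w t))"
        using that h(2) \<open>open V\<close> hol'
        by (intro continuous_on_contour_integral_param[where U = V])
           (auto simp: case_prod_unfold o_def prod.swap_def)
      moreover have "continuous_on {0..1} h"
        using vh valid_path_imp_path path_def by blast
      ultimately have "continuous_on {0..1} (\<lambda>s. contour_integral (linepath x y) (\<lambda>w. F w (h s)))"
        by (rule continuous_on_compose2) (simp add: path_image_def)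
      then have "continuous_on {0..1} (\<lambda>s. contour_integral (linepath x y) (\<lambda>w. F w (h s)) * h' s)"
        by (rule continuous_on_mult[OF _ ch])
      then show ?thesis
        by (auto simp: contour_integrable_on vd intro!: integrable_continuous_real)
    qed
    have z: "contour_integral (linepath a b) (\<lambda>w. F w t) + contour_integral (linepath b c) (\<lambda>w. F w t) +
         contour_integral (linepath c a) (\<lambda>w. F w t) = 0" if "t \<in> path_image h" for t
    proof -
      have ho: "(\<lambda>w. F w t) holomorphic_on convex hull {a,b,c}"
        using hol' that h(2) tri holomorphic_on_subset by blast
      have "contour_integral (linepath a b +++ linepath b c +++ linepath c a) (\<lambda>w. F w t) = 0"
        by (rule contour_integral_unique[OF Cauchy_theorem_triangle[OF ho]])
      moreover have "(\<lambda>w. F w t) contour_integrable_on linepath x y" if "closed_segment x y \<subseteq> V" for x y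
        using that hol' \<open>t \<in> path_image h\<close> h(2) \<open>open V\<close>
        by (intro contour_integrable_holomorphic_simple[of _ V]) auto
      ultimately show ?thesis
        using seg by (simp add: contour_integral_join contour_integrable_joinI add.assoc)
    qed
    have "contour_integral (linepath a b) (\<lambda>w. contour_integral h (F w)) +
        contour_integral (linepath b c) (\<lambda>w. contour_integral h (F w)) +
        contour_integral (linepath c a) (\<lambda>w. contour_integral h (F w)) =
        contour_integral h (\<lambda>t. contour_integral (linepath a b) (\<lambda>w. F w t) +
          contour_integral (linepath b c) (\<lambda>w. F w t) + contour_integral (linepath c a) (\<lambda>w. F w t))"
      by (simp add: sw seg int contour_integral_add contour_integrable_add)
    also have "\<dots> = contour_integral h (\<lambda>t. 0)"
      by (rule contour_integral_eq) (rule z)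
    finally show "contour_integral (linepath a b) (\<lambda>w. contour_integral h (F w)) +
        contour_integral (linepath b c) (\<lambda>w. contour_integral h (F w)) +
        contour_integral (linepath c a) (\<lambda>w. contour_integral h (F w)) = 0" by simp
  qed
  then have "(\<lambda>x. contour_integral h (F x)) holomorphic_on V"
    using \<open>open V\<close> analytic_on_open by blast
  then show ?thesis
    by (rule holomorphic_transform) (simp add: h(3) hol)
qed

text \<open>Osgood's lemma on the diagonal: the value is the Cauchy integral of f w t / (w - t) in w, which is
  holomorphic in the parameter t.\<close>

lemma holomorphic_on_diagonal:
  fixes f :: "complex \<Rightarrow> complex \<Rightarrow> complex"
  assumes cont: "continuous_on (U \<times> U) (\<lambda>(s, t). f s t)" and "open U"
    and h1: "\<And>t. t \<in> U \<Longrightarrow> (\<lambda>s. f s t) holomorphic_on U"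
    and h2: "\<And>s. s \<in> U \<Longrightarrow> f s holomorphic_on U"
  shows "(\<lambda>t. f t t) holomorphic_on U"
proof -
  have "(\<lambda>t. f t t) analytic_on {z}" if "z \<in> U" for z
  proof -
    obtain r where r: "r > 0" "cball z r \<subseteq> U"
      using \<open>open U\<close> \<open>z \<in> U\<close> open_contains_cball by blast
    \<comment> \<open>Disjointness of \<open>U'\<close> and \<open>V\<close> keeps
      \<open>w - t\<close> nonzero, while the circle of radius \<open>r\<close> still lies in
      \<open>U'\<close>.\<close>
    define U' where "U' = U - cball z (r/2)"
    define V where "V = ball z (r/2)"
    have V: "V \<subseteq> U" "V \<subseteq> ball z r" using r by (auto simp: V_def subset_iff)
    have ne: "w - t \<noteq> 0" if "w \<in> U'" "t \<in> V" for w t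
      using that by (auto simp: U'_def V_def)
    have "(\<lambda>t. contour_integral (circlepath z r) (\<lambda>w. f w t / (w - t))) holomorphic_on V"
    proof (rule holomorphic_on_contour_integral_param)
      have "continuous_on (V \<times> U') (\<lambda>y. (\<lambda>(s,t). f s t) (snd y, fst y) / (snd y - fst y))"
        using V ne by (intro continuous_intros continuous_on_compose2[OF cont]) (auto simp: U'_def)
      then show "continuous_on (V \<times> U') (\<lambda>(t, w). f w t / (w - t))"
        by (simp add: case_prod_unfold)
      show "open U'" unfolding U'_def using \<open>open U\<close> by auto
      show "open V" unfolding V_def by auto
      show "path_image (circlepath z r) \<subseteq> U'"
        using r by (auto simp: U'_def dist_norm)
      show "(\<lambda>w. f w t / (w - t)) holomorphic_on U'" if "t \<in> V" for t
        using that V ne by (intro holomorphic_intros holomorphic_on_subset[OF h1]) (auto simp: U'_def)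
      show "(\<lambda>t. f w t / (w - t)) holomorphic_on V" if "w \<in> U'" for w
        using that V ne by (intro holomorphic_intros holomorphic_on_subset[OF h2]) (auto simp: U'_def)
    qed auto
    moreover have "contour_integral (circlepath z r) (\<lambda>w. f w t / (w - t)) = 2 * of_real pi * \<i> * f t t"
      if "t \<in> V" for t
    proof -
      have "(\<lambda>s. f s t) holomorphic_on cball z r"
        using h1 r(2) V that holomorphic_on_subset by blast
      then have "((\<lambda>w. f w t / (w - t)) has_contour_integral 2 * of_real pi * \<i> * f t t) (circlepath z r)"
        using that V
        by (intro Cauchy_integral_circlepath[where f = "\<lambda>s. f s t"] holomorphic_on_imp_continuous_on)
           (auto simp: dist_norm norm_minus_commute intro: holomorphic_on_subset)
      then show ?thesis by (rule contour_integral_unique)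
    qed
    ultimately have "(\<lambda>t. 2 * of_real pi * \<i> * f t t) holomorphic_on V"
      by (rule holomorphic_transform)
    then have "(\<lambda>t. (2 * of_real pi * \<i> * f t t) * (1 / (2 * of_real pi * \<i>))) holomorphic_on V"
      by (rule holomorphic_on_mult[OF _ holomorphic_on_const])
    then have "(\<lambda>t. f t t) holomorphic_on V" by simp
    moreover have "open V" "z \<in> V" using r by (auto simp: V_def)
    ultimately show ?thesis using analytic_at by blast
  qed
  then show ?thesis
    using analytic_imp_holomorphic analytic_on_analytic_at by blast
qed

text \<open>Points are functions on all naturals, with the product topology. The first
  \<open>k\<close> coordinates are the integration variables; the others carry continuity only and
  later hold the auxiliary point z, so that one notion covers both the integration and the limit in
  z.\<close>

definition separately_holomorphic ::
  "(nat \<Rightarrow> complex set) \<Rightarrow> nat \<Rightarrow> ((nat \<Rightarrow> complex) \<Rightarrow> complex) \<Rightarrow> bool" where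
  "separately_holomorphic U k F \<longleftrightarrow> continuous_on (Pi UNIV U) F \<and>
     (\<forall>u\<in>Pi UNIV U. \<forall>i<k. (\<lambda>t. F (u(i := t))) holomorphic_on U i)"

lemma separately_holomorphic_subset:
  assumes "separately_holomorphic U k F" "\<And>i. V i \<subseteq> U i"
  shows "separately_holomorphic V k F"
proof -
  have "Pi UNIV V \<subseteq> Pi UNIV U" using assms(2) by (auto simp: Pi_def)
  then show ?thesis
    using assms unfolding separately_holomorphic_def
    by (meson continuous_on_subset holomorphic_on_subset subsetD)
qed

lemma separately_holomorphic_contour_integral:
  assumes F: "separately_holomorphic U k F" and "n < k" and op: "\<And>i. i < k \<Longrightarrow> open (U i)"
    and g: "valid_path g" "path_image g \<subseteq> U n"
  shows "separately_holomorphic U k (\<lambda>u. contour_integral g (\<lambda>t. F (u(n := t))))"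
  unfolding separately_holomorphic_def
proof (intro conjI ballI allI impI)
  have cont: "continuous_on (Pi UNIV U) F"
    and hol: "\<And>u i. u \<in> Pi UNIV U \<Longrightarrow> i < k \<Longrightarrow> (\<lambda>t. F (u(i := t))) holomorphic_on U i"
    using F unfolding separately_holomorphic_def by auto
  have "continuous_on (Pi UNIV U \<times> U n) (\<lambda>y. F ((fst y)(n := snd y)))"
  proof (intro continuous_on_compose2[OF cont] continuous_on_coordinatewise_then_product)
    show "continuous_on (Pi UNIV U \<times> U n) (\<lambda>x. ((fst x)(n := snd x)) i)" for i
      using continuous_on_product_then_coordinatewise[OF continuous_on_fst[OF continuous_on_id]]
        continuous_on_snd[OF continuous_on_id]
      by (cases "i = n") simp_all
  qed (auto simp: Pi_def)
  then show "continuous_on (Pi UNIV U) (\<lambda>u. contour_integral g (\<lambda>t. F (u(n := t))))"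
    using hol op g \<open>n < k\<close>
    by (intro continuous_on_contour_integral_param[where U = "U n"]) (auto simp: case_prod_unfold)
  fix u i assume u: "u \<in> Pi UNIV U" and i: "i < k"
  show "(\<lambda>s. contour_integral g (\<lambda>t. F ((u(i := s))(n := t)))) holomorphic_on U i"
  \<comment> \<open>For \<open>i = n\<close> the update at \<open>n\<close> overwrites the one at
    \<open>i\<close>, and the function is constant. The integrated coordinate stays as a dummy,
    which leaves \<open>U\<close> and \<open>k\<close> unchanged through the iteration.\<close>
  proof (cases "i = n")
    case False
    have "continuous_on (U i \<times> U n) (\<lambda>y. F (u(i := fst y, n := snd y)))"
    proof (intro continuous_on_compose2[OF cont] continuous_on_coordinatewise_then_product)
      show "continuous_on (U i \<times> U n) (\<lambda>y. (u(i := fst y, n := snd y)) j)" for j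
        by (cases "j = n"; cases "j = i") (auto intro!: continuous_intros)
    qed (use u in \<open>auto simp: Pi_def\<close>)
    moreover have "(\<lambda>t. F (u(i := s, n := t))) holomorphic_on U n" if "s \<in> U i" for s
      using u that \<open>n < k\<close> by (intro hol) (auto simp: Pi_def)
    moreover have "(\<lambda>s. F (u(i := s, n := t))) holomorphic_on U i" if "t \<in> U n" for t
      using hol[of "u(n := t)" i] u that i False by (auto simp: Pi_def fun_upd_twist)
    ultimately show ?thesis
      using op g i \<open>n < k\<close>
      by (intro holomorphic_on_contour_integral_param[where U = "U n"]) (auto simp: case_prod_unfold)
  qed auto
qed

lemma separately_holomorphic_icint:
  assumes "separately_holomorphic U k F" and "\<And>i. i < k \<Longrightarrow> open (U i)"
    and "\<And>i. i < k \<Longrightarrow> valid_path (g i)" "\<And>i. i < k \<Longrightarrow> path_image (g i) \<subseteq> U i" "n \<le> k"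
  shows "separately_holomorphic U k (icint g n F)"
  using \<open>n \<le> k\<close>
proof (induction n)
  case 0
  then show ?case using assms(1) by (simp add: separately_holomorphic_def)
next
  case (Suc n)
  then have "separately_holomorphic U k (\<lambda>u. contour_integral (g n) (\<lambda>t. icint g n F (u(n := t))))"
    using assms by (intro separately_holomorphic_contour_integral) auto
  then show ?case by (simp add: separately_holomorphic_def)
qed

text \<open>Additivity of the contour integral requires integrability at every level; it comes from
  separate holomorphy of the partially integrated functions.\<close>

lemma icint_sum:
  assumes F: "\<And>j. j \<in> J \<Longrightarrow> separately_holomorphic U k (F j)" and "\<And>i. i < k \<Longrightarrow> open (U i)"
    and "\<And>i. i < k \<Longrightarrow> valid_path (g i)" "\<And>i. i < k \<Longrightarrow> path_image (g i) \<subseteq> U i"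
    and "finite J" and "n \<le> k" "u \<in> Pi UNIV U"
  shows "icint g n (\<lambda>u. \<Sum>j\<in>J. a j * F j u) u = (\<Sum>j\<in>J. a j * icint g n (F j) u)"
  using \<open>n \<le> k\<close> \<open>u \<in> Pi UNIV U\<close>
proof (induction n arbitrary: u)
  case (Suc n)
  have int: "(\<lambda>t. icint g n (F j) (u(n := t))) contour_integrable_on g n" if "j \<in> J" for j
    using separately_holomorphic_icint[OF F[OF that], of g n] assms Suc.prems
    by (intro contour_integrable_holomorphic_simple[of _ "U n"]) (auto simp: separately_holomorphic_def)
  have "icint g (Suc n) (\<lambda>u. \<Sum>j\<in>J. a j * F j u) u =
    contour_integral (g n) (\<lambda>t. \<Sum>j\<in>J. a j * icint g n (F j) (u(n := t)))"
    using Suc assms(4)[of n] by (auto intro!: contour_integral_eq Suc.IH simp: Pi_def)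
  also have "\<dots> = (\<Sum>j\<in>J. a j * icint g (Suc n) (F j) u)"
    using int \<open>finite J\<close>
    by (simp add: contour_integral_sum contour_integrable_lmul contour_integral_lmul)
  finally show ?case .
qed auto

text \<open>Coordinates below \<open>n\<close> of the starting points are overwritten, the others
  are passed on unchanged. Letting starting points and integrands both differ makes it possible to
  trade coordinates that store z for a fixed parameter z.\<close>

lemma icint_cong:
  assumes "\<And>v v'. (\<And>i. i < n \<Longrightarrow> v i \<in> path_image (g i)) \<Longrightarrow> (\<And>i. i < n \<Longrightarrow> v' i = v i) \<Longrightarrow>
      (\<And>i. n \<le> i \<Longrightarrow> v i = u i) \<Longrightarrow> (\<And>i. n \<le> i \<Longrightarrow> v' i = u' i) \<Longrightarrow> F v = G v'"
  shows "icint g n F u = icint g n G u'"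
  using assms
proof (induction n arbitrary: u u')
  case (Suc n)
  show ?case unfolding icint.simps
  proof (intro contour_integral_eq Suc.IH)
    fix t v v' assume *: "t \<in> path_image (g n)" "\<And>i. i < n \<Longrightarrow> v i \<in> path_image (g i)"
      "\<And>i. i < n \<Longrightarrow> v' i = v i"
      "\<And>i. n \<le> i \<Longrightarrow> v i = (u(n := t)) i" "\<And>i. n \<le> i \<Longrightarrow> v' i = (u'(n := t)) i"
    show "F v = G v'"
    proof (rule Suc.prems)
      fix i
      show "i < Suc n \<Longrightarrow> v i \<in> path_image (g i)" "i < Suc n \<Longrightarrow> v' i = v i"
        using * by (auto simp: less_Suc_eq)
      show "Suc n \<le> i \<Longrightarrow> v i = u i" "Suc n \<le> i \<Longrightarrow> v' i = u' i"
        using * by auto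
    qed
  qed
next
  case 0
  then show ?case by simp
qed

text \<open>The recursion of \<open>icint\<close> peels off the outermost variable, which has the
  largest index. The residue computation consumes the innermost one, index 0, and renumbers the
  rest.\<close>

lemma icint_Suc_inner:
  "icint g (Suc n) F u =
   icint (\<lambda>i. g (Suc i)) n (\<lambda>v. contour_integral (g 0) (\<lambda>t. F (case_nat t v))) (\<lambda>i. u (Suc i))"
proof (induction n arbitrary: u)
  case 0
  have "u(0 := t) = case_nat t (\<lambda>i. u (Suc i))" for t
    by (auto simp: fun_eq_iff split: nat.split)
  then show ?case by simp
next
  case (Suc n)
  have "(\<lambda>i. (u(Suc n := t)) (Suc i)) = (\<lambda>i. u (Suc i))(n := t)" for t
    by auto
  then show ?case by (subst icint.simps, subst Suc.IH) simp
qed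

section \<open>Residues and nested contours\<close>

text \<open>Subtracting \<open>r z / (t - z)\<close> leaves a removable singularity, so the poles
  are discharged one at a time. \<open>S\<close> is only assumed open: the set to which this is
  applied is cut out by inequalities and need not be connected.\<close>

lemma contour_integral_simple_poles:
  assumes "finite Z" "Z \<subseteq> S" "open S" "f holomorphic_on S - Z"
    and "\<And>z. z \<in> Z \<Longrightarrow> ((\<lambda>t. (t - z) * f t) \<longlongrightarrow> r z) (at z)"
    and g: "valid_path g" "pathfinish g = pathstart g" "path_image g \<subseteq> S - Z"
    and wn: "\<And>w. w \<notin> S \<Longrightarrow> winding_number g w = 0"
  shows "contour_integral g f = 2 * of_real pi * \<i> * (\<Sum>z\<in>Z. winding_number g z * r z)"
  using assms(1,2,4,5) g(3)
proof (induction Z arbitrary: f)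
  case empty
  then have "(f has_contour_integral 0) g"
    using \<open>open S\<close> g wn by (intro Cauchy_theorem_global[of S]) auto
  then show ?case by (simp add: contour_integral_unique)
next
  case (insert z Z)
  define \<phi> where "\<phi> = (\<lambda>t. f t - r z / (t - z))"
  have op: "open (S - Z)" using \<open>open S\<close> insert.hyps by (simp add: finite_imp_closed open_Diff)
  have "\<phi> holomorphic_on (S - Z) - {z}"
    unfolding \<phi>_def using insert.prems
    by (intro holomorphic_intros holomorphic_on_subset[OF insert.prems(2)]) auto
  moreover have "z \<in> interior (S - Z)"
    using op insert by (simp add: interior_open)
  moreover have "((\<lambda>t. (t - z) * \<phi> t) \<longlongrightarrow> 0) (at z)"
  proof (rule Lim_transform_eventually)
    show "((\<lambda>t. (t - z) * f t - r z) \<longlongrightarrow> 0) (at z)"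
      using tendsto_diff[OF insert.prems(3)[of z] tendsto_const[of "r z"]] by simp
    show "\<forall>\<^sub>F t in at z. (t - z) * f t - r z = (t - z) * \<phi> t"
      using eventually_neq_at_within[of z z UNIV]
      by eventually_elim (simp add: \<phi>_def right_diff_distrib)
  qed
  ultimately obtain h where h: "h holomorphic_on S - Z" "\<And>t. t \<in> S - Z - {z} \<Longrightarrow> h t = \<phi> t"
    using holomorphic_on_extend_lim by blast
  \<comment> \<open>The subtracted term is regular at the other poles, so their limits do not
    change.\<close>
  have lim: "((\<lambda>t. (t - z') * h t) \<longlongrightarrow> r z') (at z')" if z': "z' \<in> Z" for z'
  proof (rule Lim_transform_eventually)
    have "z' \<noteq> z" using z' insert.hyps by auto
    then have "((\<lambda>t. (t - z') * f t - (t - z') * (r z / (t - z))) \<longlongrightarrow> r z' - (z' - z') * (r z / (z' - z))) (at z')"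
      using z' by (intro tendsto_intros insert.prems(3)) auto
    then show "((\<lambda>t. (t - z') * f t - (t - z') * (r z / (t - z))) \<longlongrightarrow> r z') (at z')" by simp
    have "open (S - (Z - {z'}) - {z})" "z' \<in> S - (Z - {z'}) - {z}"
      using \<open>open S\<close> insert.hyps insert.prems \<open>z' \<noteq> z\<close> z' by (auto simp: finite_imp_closed open_Diff)
    then have "\<forall>\<^sub>F t in at z'. t \<in> S - (Z - {z'}) - {z}"
      by (rule eventually_at_in_open')
    then show "\<forall>\<^sub>F t in at z'. (t - z') * f t - (t - z') * (r z / (t - z)) = (t - z') * h t"
      using eventually_neq_at_within[of z' z' UNIV]
      by eventually_elim (auto simp: h(2) \<phi>_def algebra_simps)
  qed
  have pz: "z \<notin> path_image g" using insert.prems by auto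
  have IH: "contour_integral g h = 2 * of_real pi * \<i> * (\<Sum>z\<in>Z. winding_number g z * r z)"
    using insert.prems by (intro insert.IH h(1) lim) auto
  have i1: "h contour_integrable_on g"
    using h(1) op g(1) insert.prems by (intro contour_integrable_holomorphic_simple[of _ "S - Z"]) auto
  have i2: "(\<lambda>t. 1 / (t - z)) contour_integrable_on g"
    using g(1) pz by (rule contour_integrable_inversediff)
  have "contour_integral g f = contour_integral g (\<lambda>t. h t + r z * (1 / (t - z)))"
  proof (rule contour_integral_eq)
    fix x assume "x \<in> path_image g"
    then have "x \<in> S - Z - {z}" using insert.prems by auto
    then show "f x = h x + r z * (1 / (x - z))" by (simp only: h(2)) (simp add: \<phi>_def)
  qed
  also have "\<dots> = contour_integral g h + r z * contour_integral g (\<lambda>t. 1 / (t - z))"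
    using i1 i2 by (simp add: contour_integral_add contour_integral_lmul contour_integrable_lmul del: times_divide_eq_right)
  also have "contour_integral g (\<lambda>t. 1 / (t - z)) = 2 * of_real pi * \<i> * winding_number g z"
    using winding_number_valid_path[OF g(1) pz] by simp
  finally show ?case
    using insert.hyps by (simp add: IH algebra_simps)
qed

text \<open>Jordan curve theorem: the winding number is 1 or -1 inside and 0 outside. This converts
  contour hypotheses, stated by winding numbers, into inclusions between insides.\<close>

lemma inside_simple_closed_path_iff:
  assumes "simple_path g" "pathfinish g = pathstart g"
  shows "w \<in> inside (path_image g) \<longleftrightarrow> w \<notin> path_image g \<and> winding_number g w \<noteq> 0"
proof
  assume w: "w \<in> inside (path_image g)"
  then show "w \<notin> path_image g \<and> winding_number g w \<noteq> 0"
    using simple_closed_path_winding_number_inside[OF assms(1)] inside_no_overlap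
    by (metis disjoint_iff zero_neq_neg_one zero_neq_one)
next
  assume w: "w \<notin> path_image g \<and> winding_number g w \<noteq> 0"
  then have "w \<notin> outside (path_image g)"
    using winding_number_zero_in_outside assms simple_path_imp_path by blast
  then show "w \<in> inside (path_image g)"
    using w inside_Un_outside by blast
qed

section \<open>Nested closed curves and their translates\<close>

lemma winding_number_inside_eq:
  assumes "simple_path g" "pathfinish g = pathstart g"
    and "z \<in> inside (path_image g)" "w \<in> inside (path_image g)"
  shows "winding_number g z = winding_number g w"
  using simple_closed_path_winding_number_inside[OF assms(1)] assms(3,4) by metis

lemma path_image_translate: "path_image (\<lambda>t. g t + v) = (\<lambda>x. x + v) ` path_image g"
  for v :: "'a::real_normed_vector"
  by (auto simp: path_image_def)

lemma simple_path_translate: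
  fixes v :: complex
  assumes "simple_path g"
  shows "simple_path (\<lambda>t. g t + v)"
  using assms simple_path_translation_eq[of v g] by (simp add: o_def add.commute)

lemma inside_path_image_translate:
  fixes v :: complex
  assumes "simple_path g" "pathfinish g = pathstart g"
  shows "inside (path_image (\<lambda>t. g t + v)) = (\<lambda>x. x + v) ` inside (path_image g)"
proof -
  have wn: "winding_number (\<lambda>t. g t + v) w = winding_number g (w - v)" for w
    by (subst (1 2) winding_number_offset) (simp add: algebra_simps)
  have tr: "w \<in> (\<lambda>x. x + v) ` A \<longleftrightarrow> w - v \<in> A" for w A
  proof
    show "w - v \<in> A \<Longrightarrow> w \<in> (\<lambda>x. x + v) ` A"
      by (rule image_eqI[of _ _ "w - v"]) simp_all
  qed auto
  have "w \<in> inside (path_image (\<lambda>t. g t + v)) \<longleftrightarrow> w - v \<in> inside (path_image g)" for w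
  proof -
    have "pathfinish (\<lambda>t. g t + v) = pathstart (\<lambda>t. g t + v)"
      using assms(2) by (simp add: pathfinish_def pathstart_def)
    then show ?thesis
      using assms simple_path_translate[OF assms(1), of v]
      by (simp add: inside_simple_closed_path_iff wn) (simp only: path_image_translate tr)
  qed
  then show ?thesis by (intro Set.set_eqI) (simp only: tr)
qed

lemma connected_subset_inside:
  fixes X K :: "'a::euclidean_space set"
  assumes "connected X" "closed K" "X \<inter> K = {}" "X \<inter> inside K \<noteq> {}"
  shows "X \<subseteq> inside K"
proof -
  have "open (inside K)" "open (outside K)"
    using assms by (auto simp: open_inside open_outside)
  moreover have "X \<subseteq> inside K \<union> outside K"
    using assms by (metis disjoint_eq_subset_Compl inside_Un_outside)
  ultimately have "outside K \<inter> X = {}"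
    using connectedD[OF assms(1), of "inside K" "outside K"] assms(4) inside_Int_outside[of K] by blast
  then show ?thesis using \<open>X \<subseteq> inside K \<union> outside K\<close> by blast
qed

text \<open>If \<open>x0\<close> minimises the inner product with \<open>v\<close> on
  \<open>K\<close>, the translate lies in the half-space where that product is at least its value at
  \<open>x0\<close> plus \<open>v \<bullet> v\<close>. By convexity the inside of the translate lies
  there too, so it can contain \<open>x0\<close> only if \<open>v = 0\<close>; but \<open>K\<close>
  does not meet its own inside.\<close>

lemma not_subset_inside_translate:
  fixes K :: "'a::euclidean_space set"
  assumes "compact K" "K \<noteq> {}"
  shows "\<not> K \<subseteq> inside ((\<lambda>x. x + v) ` K)"
proof
  assume sub: "K \<subseteq> inside ((\<lambda>x. x + v) ` K)"
  obtain x0 where x0: "x0 \<in> K" "\<And>x. x \<in> K \<Longrightarrow> x0 \<bullet> v \<le> x \<bullet> v"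
    using continuous_attains_inf[OF assms continuous_on_inner[OF continuous_on_id continuous_on_const]]
    by blast
  define C where "C = {y. y \<bullet> v \<ge> x0 \<bullet> v + v \<bullet> v}"
  have "convex C"
    unfolding C_def by (subst inner_commute) (rule convex_halfspace_ge)
  moreover have KC: "(\<lambda>x. x + v) ` K \<subseteq> C"
    using x0 by (auto simp: C_def inner_add_left)
  ultimately have "inside ((\<lambda>x. x + v) ` K) \<subseteq> C"
    using outside_subset_convex inside_Int_outside by blast
  then have "x0 \<in> C" using sub x0 by auto
  then have "v \<bullet> v \<le> 0" by (simp add: C_def)
  then have "v = 0" by (metis inner_eq_zero_iff inner_ge_zero order_antisym)
  then show False using sub x0 inside_no_overlap[of K] by (simp) (metis disjoint_iff inside_no_overlap subsetD)
qed

text \<open>Excludes the zeros of exp u - exp (t + a), with t the inner variable and u on the outer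
  curve. If t were inside \<open>g\<close>, the translate of \<open>g\<close> by \<open>a\<close>
  minus a period would enclose \<open>h\<close>, which encloses the translate of \<open>g\<close> by
  \<open>a\<close>: a curve would lie inside its own translate.\<close>

lemma winding_number_zero_preimage_shift:
  assumes g: "simple_path g" "pathfinish g = pathstart g" and h: "path h"
    and nest: "path_image (\<lambda>t. g t + a) \<subseteq> inside (path_image h)"
    and avoid: "\<And>x v. x \<in> path_image g \<Longrightarrow> v \<in> path_image h \<Longrightarrow> exp v \<noteq> exp (x + a)"
    and "u \<in> path_image h" "exp (t + a) = exp u"
  shows "winding_number g t = 0"
proof (rule ccontr)
  assume wn: "winding_number g t \<noteq> 0"
  define s where "s = t + a - u"
  have s: "exp s = 1" using assms(7) by (simp add: s_def exp_diff)
  have tin: "t \<in> inside (path_image g)"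
    using wn avoid[of t u] assms(6,7) g by (auto simp: inside_simple_closed_path_iff)
  define g' where "g' = (\<lambda>r. g r + (a - s))"
  have pg': "path_image g' = (\<lambda>x. x - s) ` path_image (\<lambda>t. g t + a)"
    by (auto simp: g'_def path_image_def)
  have "path_image h \<inter> path_image g' = {}"
  proof -
    have "x + (a - s) \<notin> path_image h" if "x \<in> path_image g" for x
      using avoid[OF that, of "x + (a - s)"] s by (auto simp: exp_add exp_diff)
    then show ?thesis by (auto simp: g'_def path_image_translate)
  qed
  moreover have "u \<in> inside (path_image g')"
    unfolding g'_def inside_path_image_translate[OF g] using tin by (auto simp: s_def)
  moreover have cg': "closed (path_image g')" "compact (path_image g')" "connected (path_image g')"
    using simple_path_translate[OF g(1), of "a - s"] simple_path_imp_path unfolding g'_def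
    by (auto intro: compact_imp_closed compact_simple_path_image connected_path_image)
  ultimately have "path_image h \<subseteq> inside (path_image g')"
    using assms(6) h by (intro connected_subset_inside connected_path_image) auto
  then have "inside (path_image h) \<subseteq> inside (path_image g')"
    using cg' h by (intro inside_inside_compact_connected) (auto simp: closed_path_image)
  then have "path_image (\<lambda>t. g t + a) \<subseteq> inside ((\<lambda>x. x + (- s)) ` path_image (\<lambda>t. g t + a))"
    using nest pg' by auto
  then show False
    using not_subset_inside_translate[of "path_image (\<lambda>t. g t + a)" "-s"]
      compact_simple_path_image[OF simple_path_translate[OF g(1)]] path_image_nonempty by blast
qed

text \<open>Excludes the zeros of exp (u + d) - exp t in the inner variable t. If t were inside
  \<open>g\<close>, the translate of \<open>h\<close> that carries u to t would lie inside
  \<open>g\<close>; translating once more by \<open>a\<close> moves it inside \<open>h\<close>,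
  again contradicting \<open>not_subset_inside_translate\<close>.\<close>

lemma winding_number_zero_image_shift:
  assumes g: "simple_path g" "pathfinish g = pathstart g"
    and h: "simple_path h" "pathfinish h = pathstart h"
    and nest: "path_image (\<lambda>t. g t + a) \<subseteq> inside (path_image h)"
    and avoid: "\<And>x v. x \<in> path_image g \<Longrightarrow> v \<in> path_image h \<Longrightarrow> exp (v + d) \<noteq> exp x"
    and "u \<in> path_image h" "exp t = exp (u + d)"
  shows "winding_number g t = 0"
proof (rule ccontr)
  assume wn: "winding_number g t \<noteq> 0"
  have tin: "t \<in> inside (path_image g)"
    using wn avoid[of t u] assms(7,8) g by (auto simp: inside_simple_closed_path_iff)
  define h' where "h' = (\<lambda>r. h r + (t - u))"
  have ph': "path_image h' = (\<lambda>x. x + (t - u)) ` path_image h"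
    by (auto simp: h'_def path_image_def)
  have pathh': "path h'" "path h"
    using simple_path_translate[OF h(1)] h simple_path_imp_path unfolding h'_def by blast+
  have "path_image h' \<inter> path_image g = {}"
  proof -
    have "v + (t - u) \<notin> path_image g" if "v \<in> path_image h" for v
      using avoid[OF _ that, of "v + (t - u)"] assms(8) by (auto simp: exp_add exp_diff)
    then show ?thesis by (auto simp: ph')
  qed
  moreover have "t \<in> path_image h'"
    unfolding ph' using assms(7) by (auto simp: image_iff)
  ultimately have "path_image h' \<subseteq> inside (path_image g)"
    using tin g(1) pathh'
    by (intro connected_subset_inside connected_path_image)
       (auto intro: compact_imp_closed compact_simple_path_image)
  then have "(\<lambda>x. x + a) ` path_image h' \<subseteq> inside (path_image (\<lambda>t. g t + a))"
    unfolding inside_path_image_translate[OF g] by auto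
  also have "\<dots> \<subseteq> inside (path_image h)"
    using simple_path_translate[OF g(1), of a] h nest
    by (intro inside_inside_compact_connected)
       (auto intro: compact_imp_closed compact_simple_path_image connected_simple_path_image)
  finally have "(\<lambda>x. x + (t - u + a)) ` path_image h \<subseteq> inside (path_image h)"
    by (simp add: ph' image_image add.assoc)
  then have "path_image h \<subseteq> (\<lambda>x. x + (- (t - u + a))) ` inside (path_image h)"
    by (force simp: image_iff algebra_simps)
  also have "\<dots> = inside ((\<lambda>x. x + (- (t - u + a))) ` path_image h)"
    by (simp add: inside_path_image_translate[OF h, symmetric] path_image_translate)
  finally show False
    using not_subset_inside_translate[of "path_image h"] h(1) compact_simple_path_image path_image_nonempty
    by blast
qed

text \<open>Hypothesis \<open>per\<close> gives winding number 0 on the translated curve; the claim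
  concerns the points it encloses. The outer curve \<open>h\<close> cannot enter that region, or the
  translate of \<open>g\<close> by \<open>a\<close> would lie inside its own translate by
  \<open>s\<close>; hence the winding number of \<open>h\<close> is constant on the closed
  region.\<close>

lemma winding_number_zero_period_shift:
  assumes g: "simple_path g" "pathfinish g = pathstart g"
    and h: "path h" "pathfinish h = pathstart h"
    and nest: "path_image (\<lambda>t. g t + a) \<subseteq> inside (path_image h)"
    and avoid: "\<And>x v. x \<in> path_image g \<Longrightarrow> v \<in> path_image h \<Longrightarrow> exp v \<noteq> exp (x + a)"
    and s: "exp s = 1" and per: "\<And>x. x \<in> path_image g \<Longrightarrow> winding_number h (x + a + s) = 0"
    and z: "z \<in> inside (path_image g)"
  shows "z + a + s \<notin> path_image h \<and> winding_number h (z + a + s) = 0"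
proof -
  define g' where "g' = (\<lambda>r. g r + (a + s))"
  have pg': "path_image g' = (\<lambda>x. x + s) ` path_image (\<lambda>t. g t + a)"
    by (auto simp: g'_def path_image_def algebra_simps)
  have sg': "simple_path g'" "pathfinish g' = pathstart g'"
    unfolding g'_def using simple_path_translate g by (auto simp: pathfinish_def pathstart_def)
  have J: "open (inside (path_image g'))" "connected (inside (path_image g'))"
    "frontier (inside (path_image g')) = path_image g'"
    using Jordan_inside_outside[OF sg'] by auto
  have cg': "closed (path_image g')" "compact (path_image g')" "connected (path_image g')"
    using sg' by (auto intro: compact_imp_closed compact_simple_path_image connected_simple_path_image)
  have disj: "path_image h \<inter> path_image g' = {}"
  proof -
    have "x + (a + s) \<notin> path_image h" if "x \<in> path_image g" for x
      using avoid[OF that, of "x + (a + s)"] s by (auto simp: exp_add)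
    then show ?thesis by (auto simp: g'_def path_image_translate)
  qed
  have disj2: "path_image h \<inter> inside (path_image g') = {}"
  proof (rule ccontr)
    assume "path_image h \<inter> inside (path_image g') \<noteq> {}"
    then have "path_image h \<subseteq> inside (path_image g')"
      using disj cg' h by (intro connected_subset_inside connected_path_image) auto
    then have "inside (path_image h) \<subseteq> inside (path_image g')"
      using cg' h by (intro inside_inside_compact_connected) (auto simp: closed_path_image)
    then have "path_image (\<lambda>t. g t + a) \<subseteq> inside ((\<lambda>x. x + s) ` path_image (\<lambda>t. g t + a))"
      using nest pg' by auto
    then show False
      using not_subset_inside_translate[of "path_image (\<lambda>t. g t + a)" s]
        compact_simple_path_image[OF simple_path_translate[OF g(1)]] path_image_nonempty by blast
  qed
  define X where "X = closure (inside (path_image g'))"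
  have X: "X = inside (path_image g') \<union> path_image g'"
    unfolding X_def closure_Un_frontier J(3) by auto
  have "winding_number h constant_on X"
    using h disj disj2 connected_imp_connected_closure[OF J(2)] X
    by (intro winding_number_constant) (auto simp: X_def)
  moreover have zX: "z + a + s \<in> X" "z + a + s \<in> inside (path_image g')"
    unfolding X g'_def inside_path_image_translate[OF g] using z by (auto simp: image_iff add.assoc)
  moreover have "pathstart g + a + s \<in> X"
    unfolding X g'_def path_image_translate using pathstart_in_path_image[of g] by (auto simp: image_iff add.assoc)
  moreover have "winding_number h (pathstart g + a + s) = 0"
    by (rule per[OF pathstart_in_path_image])
  ultimately show ?thesis
    using disj2 unfolding constant_on_def by (metis disjoint_iff)
qed

section \<open>Schur functions at geometric progressions\<close>

text \<open>The matrix of the monic polynomials with roots y 0, ..., y (i - 1), evaluated at the y j, is triangular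
  and differs from the Vandermonde matrix by a unitriangular factor.\<close>

lemma vandermonde_leibniz:
  fixes y :: "nat \<Rightarrow> complex"
  shows "(\<Sum>\<sigma> | \<sigma> permutes {..<n}. of_int (sign \<sigma>) * (\<Prod>i<n. y (\<sigma> i) ^ i)) =
    (\<Prod>i<n. \<Prod>j\<in>{i<..<n}. (y j - y i))"
proof -
  define P where "P = (\<lambda>i. \<Prod>m<i. [:- y m, 1:])"
  define C where "C = Matrix.mat n n (\<lambda>(i,j). coeff (P i) j)"
  define A where "A = Matrix.mat n n (\<lambda>(i,j). y j ^ i)"
  define T where "T = Matrix.mat n n (\<lambda>(i,j). poly (P i) (y j))"
  have deg: "degree (P i) = i \<and> lead_coeff (P i) = 1" for i
  proof (induction i)
    case (Suc i)
    have "P (Suc i) = P i * [:- y i, 1:]" by (simp add: P_def mult.commute)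
    moreover have "P i \<noteq> 0" using Suc by force
    moreover have "[:- y i, 1:] \<noteq> 0" by simp
    ultimately have "degree (P (Suc i)) = degree (P i) + degree [:- y i, 1:]"
      and "lead_coeff (P (Suc i)) = lead_coeff (P i) * lead_coeff [:- y i, 1:]"
      using degree_mult_eq[of "P i" "[:- y i, 1:]"] lead_coeff_mult[of "P i" "[:- y i, 1:]"]
      by metis+
    then show ?case using Suc by auto
  qed (simp add: P_def)
  have carr: "C \<in> carrier_mat n n" "A \<in> carrier_mat n n" "T \<in> carrier_mat n n"
    by (auto simp: C_def A_def T_def)
  have "C * A = T"
  proof (rule eq_matI)
    fix i j assume "i < dim_row T" "j < dim_col T"
    then have ij: "i < n" "j < n" by (auto simp: T_def)
    have "(C * A) $$ (i, j) = (\<Sum>m<n. coeff (P i) m * y j ^ m)"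
      using ij by (simp add: C_def A_def scalar_prod_def atLeast0LessThan)
    also have "\<dots> = poly (P i) (y j)"
      using ij deg[of i]
      by (subst poly_altdef) (intro sum.mono_neutral_right, auto intro!: coeff_eq_0)
    finally show "(C * A) $$ (i, j) = T $$ (i, j)" using ij by (simp add: T_def)
  qed (auto simp: C_def A_def T_def)
  then have "Determinant.det C * Determinant.det A = Determinant.det T"
    using det_mult[OF carr(1,2)] by simp
  moreover have "Determinant.det C = 1"
  proof -
    have "Determinant.det C = prod_list (diag_mat C)"
      using deg by (intro det_lower_triangular[OF _ carr(1)]) (auto simp: C_def intro!: coeff_eq_0)
    also have "\<dots> = 1"
    proof -
      have "coeff (P i) i = 1" for i using deg[of i] by metis
      then show ?thesis by (simp add: prod_list_diag_prod C_def)
    qed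
    finally show ?thesis .
  qed
  moreover have "Determinant.det T = (\<Prod>j<n. \<Prod>i<j. y j - y i)"
  proof -
    have "Determinant.det T = prod_list (diag_mat T)"
      using carr by (intro det_upper_triangular[of _ n]) (auto simp: T_def upper_triangular_def P_def poly_prod)
    also have "\<dots> = (\<Prod>j<n. \<Prod>i<j. y j - y i)"
      by (auto simp: prod_list_diag_prod T_def P_def poly_prod atLeast0LessThan intro!: prod.cong)
    finally show ?thesis .
  qed
  moreover have "(\<Prod>j<n. \<Prod>i<j. y j - y i) = (\<Prod>i<n. \<Prod>j\<in>{i<..<n}. (y j - y i))"
    by (subst prod.Sigma, simp, simp, subst prod.Sigma, simp, simp)
       (rule prod.reindex_bij_witness[of _ prod.swap prod.swap], auto)
  moreover have "Determinant.det A = (\<Sum>\<sigma> | \<sigma> permutes {..<n}. of_int (sign \<sigma>) * (\<Prod>i<n. y (\<sigma> i) ^ i))"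
  proof -
    have "(\<Prod>i<n. A $$ (i, \<sigma> i)) = (\<Prod>i<n. y (\<sigma> i) ^ i)" if "\<sigma> permutes {..<n}" for \<sigma>
      using permutes_in_image[OF that] by (intro prod.cong) (auto simp: A_def)
    then show ?thesis
      using carr(2) by (simp add: Determinant.det_def atLeast0LessThan)
  qed
  ultimately show ?thesis by simp
qed

text \<open>Parts are indexed from 0, so this is the exponent lambda_j + N - j of 1-based
  notation.\<close>

definition shifted_part :: "nat \<Rightarrow> int list \<Rightarrow> nat \<Rightarrow> complex" where
  "shifted_part n l j = of_int (l ! j + int n - 1 - int j)"

lemma schur_det_exp:
  assumes "length z = n"
  shows "schur_det l (map exp z) = (\<Sum>\<sigma> | \<sigma> permutes {..<n}. of_int (sign \<sigma>) *
      (\<Prod>i<n. exp (z ! i * shifted_part n l (\<sigma> i))))"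
  using assms by (auto simp: shifted_part_def schur_det_def Let_def exp_power_int mult.commute intro!: sum.cong prod.cong)

lemma vandermonde_exp:
  assumes "length z = n"
  shows "vandermonde (map exp z) = (\<Prod>i<n. \<Prod>j\<in>{i<..<n}. (exp (z ! i) - exp (z ! j)))"
  using assms by (auto simp: vandermonde_def Let_def intro!: prod.cong)

lemma exp_diff_eq_sinh: "exp a - exp b = exp ((a + b) / 2) * (2 * sinh ((a - b) / 2))"
  for a b :: complex
proof -
  have "a = (a + b) / 2 + (a - b) / 2" "b = (a + b) / 2 - (a - b) / 2"
    by (simp_all add: field_simps)
  then have "exp a - exp b = exp ((a + b) / 2) * exp ((a - b) / 2) - exp ((a + b) / 2) * exp (- ((a - b) / 2))"
    by (metis exp_add diff_conv_add_uminus)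
  then show ?thesis by (simp add: sinh_def scaleR_conv_of_real algebra_simps)
qed

lemma sum_pairs_less:
  fixes f :: "nat \<Rightarrow> complex"
  shows "(\<Sum>i<n. \<Sum>j\<in>{i<..<n}. f i + f j) = (of_nat n - 1) * (\<Sum>i<n. f i)"
proof (induction n)
  case (Suc n)
  have "{i<..<Suc n} = insert n {i<..<n}" if "i < n" for i using that by auto
  moreover have "{n<..<Suc n} = {}" by auto
  ultimately have "(\<Sum>i<Suc n. \<Sum>j\<in>{i<..<Suc n}. f i + f j) =
      (\<Sum>i<n. (f i + f n) + (\<Sum>j\<in>{i<..<n}. f i + f j))"
    by (auto intro!: sum.cong)
  then show ?case
    unfolding sum.distrib[of "\<lambda>i. f i + f n"] Suc.IH by (simp add: sum.distrib algebra_simps)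
qed simp

text \<open>Collects the prefactors that \<open>exp_diff_eq_sinh\<close> leaves in a product over
  pairs; each index occurs in n - 1 of them.\<close>

lemma exp_sum_pairs:
  fixes f :: "nat \<Rightarrow> complex"
  shows "(\<Prod>i<n. \<Prod>j\<in>{i<..<n}. exp ((f i + f j) / 2)) = exp ((of_nat n - 1) / 2 * (\<Sum>i<n. f i))"
  using sum_pairs_less[of f n]
  by (simp add: exp_sum[symmetric] sum_divide_distrib[symmetric])

text \<open>Principal specialisation: at a geometric progression the numerator is itself a
  Vandermonde product, in the variables exp (- w L_j) with L the shifted parts. The sum in the
  exponential factor equals the sum of the parts of \<open>l\<close>.\<close>

lemma schur_geometric:
  fixes w b :: complex
  shows "schur l (map exp (map (\<lambda>i. w * (b - of_nat i)) [0..<n])) =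
    exp (w * (b - (of_nat n - 1) / 2) * (\<Sum>j<n. shifted_part n l j - of_nat j)) *
    (\<Prod>i<n. \<Prod>j\<in>{i<..<n}. sinh (w * (shifted_part n l i - shifted_part n l j) / 2) / sinh (w * (of_nat j - of_nat i) / 2))"
    (is "schur l (map exp ?z) = ?E * _")
proof -
  let ?L = "shifted_part n l"
  define y where "y = (\<lambda>j. exp (- w * ?L j))"
  have z: "length ?z = n" "\<And>i. i < n \<Longrightarrow> ?z ! i = w * (b - of_nat i)" by auto
  have perm: "(\<Sum>i<n. ?L (\<sigma> i)) = (\<Sum>i<n. ?L i)" if "\<sigma> permutes {..<n}" for \<sigma>
    using sum.permute[OF that, of ?L] by (simp add: o_def)
  have "schur_det l (map exp ?z) =
     (\<Sum>\<sigma> | \<sigma> permutes {..<n}. of_int (sign \<sigma>) * (\<Prod>i<n. exp (w * b * ?L (\<sigma> i)) * y (\<sigma> i) ^ i))"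
    unfolding schur_det_exp[OF z(1)]
    by (intro sum.cong prod.cong refl arg_cong2[of _ _ _ _ "(*)"])
       (simp add: y_def exp_of_nat_mult[symmetric] exp_add[symmetric] algebra_simps)
  also have "\<dots> = (\<Sum>\<sigma> | \<sigma> permutes {..<n}. exp (w * b * (\<Sum>j<n. ?L j)) * (of_int (sign \<sigma>) * (\<Prod>i<n. y (\<sigma> i) ^ i)))"
    using perm by (intro sum.cong refl) (simp add: prod.distrib exp_sum[symmetric] sum_distrib_left[symmetric])
  also have "\<dots> = exp (w * b * (\<Sum>j<n. ?L j)) * (\<Prod>i<n. \<Prod>j\<in>{i<..<n}. (y j - y i))"
    by (simp add: sum_distrib_left[symmetric] vandermonde_leibniz)
  also have "(\<Prod>i<n. \<Prod>j\<in>{i<..<n}. (y j - y i)) =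
      (\<Prod>i<n. \<Prod>j\<in>{i<..<n}. exp ((- w * ?L i + - w * ?L j) / 2) * (2 * sinh (w * (?L i - ?L j) / 2)))"
    unfolding y_def exp_diff_eq_sinh by (intro prod.cong refl) (simp add: algebra_simps)
  also have "\<dots> = exp ((of_nat n - 1) / 2 * (\<Sum>j<n. - w * ?L j)) *
      (\<Prod>i<n. \<Prod>j\<in>{i<..<n}. 2 * sinh (w * (?L i - ?L j) / 2))"
    by (simp only: prod.distrib exp_sum_pairs)
  finally have 1: "schur_det l (map exp ?z) = exp (w * (b - (of_nat n - 1) / 2) * (\<Sum>j<n. ?L j)) *
      (\<Prod>i<n. \<Prod>j\<in>{i<..<n}. 2 * sinh (w * (?L i - ?L j) / 2))"
    by (simp add: mult.assoc[symmetric] exp_add[symmetric] sum_distrib_left[symmetric] sum_negf)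
       (simp add: algebra_simps)
  have "vandermonde (map exp ?z) =
     (\<Prod>i<n. \<Prod>j\<in>{i<..<n}. exp ((w * (b - of_nat i) + w * (b - of_nat j)) / 2) *
        (2 * sinh (w * (of_nat j - of_nat i) / 2)))"
    unfolding vandermonde_exp[OF z(1)] by (intro prod.cong refl) (simp add: exp_diff_eq_sinh algebra_simps)
  also have "\<dots> = exp ((of_nat n - 1) / 2 * (\<Sum>j<n. w * (b - of_nat j))) *
      (\<Prod>i<n. \<Prod>j\<in>{i<..<n}. 2 * sinh (w * (of_nat j - of_nat i) / 2))"
    by (simp only: prod.distrib exp_sum_pairs)
  finally have 2: "vandermonde (map exp ?z) = \<dots>" .
  have gauss: "(\<Sum>j<n. of_nat j :: complex) = of_nat n * (of_nat n - 1) / 2"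
    by (induction n) (auto simp: field_simps)
  have E: "exp (w * (b - (of_nat n - 1) / 2) * (\<Sum>j<n. ?L j)) = ?E * exp ((of_nat n - 1) / 2 * (\<Sum>j<n. w * (b - of_nat j)))"
    unfolding exp_add[symmetric]
    by (rule arg_cong[of _ _ exp])
       (simp add: sum_distrib_left[symmetric] sum_subtractf gauss, simp add: field_simps)
  have "(\<Prod>i<n. \<Prod>j\<in>{i<..<n}. sinh (w * (?L i - ?L j) / 2) / sinh (w * (of_nat j - of_nat i) / 2)) =
      (\<Prod>i<n. \<Prod>j\<in>{i<..<n}. 2 * sinh (w * (?L i - ?L j) / 2)) /
      (\<Prod>i<n. \<Prod>j\<in>{i<..<n}. 2 * sinh (w * (of_nat j - of_nat i) / 2))"
    by (simp flip: prod_dividef)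
  then show ?thesis
    unfolding schur_def 1 2 E by simp
qed

section \<open>Limits at (1, ..., 1) and bounds from the monotonicity of sinh x / x\<close>

lemma sinh_mult_limit: "((\<lambda>w. sinh (w * a) / w) \<longlongrightarrow> a) (at 0)" for a :: complex
proof -
  have "((\<lambda>w. sinh (w * a)) has_field_derivative cosh (0 * a) * a) (at 0)"
    by (auto intro!: derivative_eq_intros)
  then show ?thesis by (simp add: has_field_derivative_iff)
qed

lemma sinh_quotient_limit:
  fixes a b :: complex
  assumes "b \<noteq> 0"
  shows "((\<lambda>w. sinh (w * a) / sinh (w * b)) \<longlongrightarrow> a / b) (at 0)"
proof (rule Lim_transform_eventually)
  show "((\<lambda>w. (sinh (w * a) / w) / (sinh (w * b) / w)) \<longlongrightarrow> a / b) (at 0)"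
    by (intro tendsto_divide sinh_mult_limit assms)
  show "\<forall>\<^sub>F w in at 0. sinh (w * a) / w / (sinh (w * b) / w) = sinh (w * a) / sinh (w * b)"
    using eventually_neq_at_within[of 0 0 UNIV] by eventually_elim simp
qed

text \<open>For a signature \<open>l\<close> this is Weyl's formula for the dimension of the
  representation of GL(n) with highest weight \<open>l\<close>.\<close>

definition weyl_dim :: "nat \<Rightarrow> int list \<Rightarrow> complex" where
  "weyl_dim n l = (\<Prod>i<n. \<Prod>j\<in>{i<..<n}. (shifted_part n l i - shifted_part n l j) / (of_nat j - of_nat i))"

text \<open>The limit does not depend on \<open>b\<close>, because the exponential prefactor tends
  to 1. The case b = n - 1 identifies \<open>schur_one\<close>, the case b = (n - 1) / 2 serves the
  central points.\<close>

lemma schur_geometric_limit: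
  "((\<lambda>w. schur l (map exp (map (\<lambda>i. w * (b - of_nat i)) [0..<n]))) \<longlongrightarrow> weyl_dim n l) (at 0)"
proof -
  have half: "(x / 2) / (y / 2) = x / y" for x y :: complex by (simp add: field_simps)
  have eqw: "weyl_dim n l = (\<Prod>i<n. \<Prod>j\<in>{i<..<n}.
      ((shifted_part n l i - shifted_part n l j) / 2) / ((of_nat j - of_nat i) / 2))"
    unfolding weyl_dim_def by (simp only: half)
  have "((\<lambda>w. schur l (map exp (map (\<lambda>i. w * (b - of_nat i)) [0..<n]))) \<longlongrightarrow>
    exp (0 * (b - (of_nat n - 1) / 2) * (\<Sum>j<n. shifted_part n l j - of_nat j)) *
    (\<Prod>i<n. \<Prod>j\<in>{i<..<n}. ((shifted_part n l i - shifted_part n l j) / 2) / ((of_nat j - of_nat i) / 2))) (at 0)"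
    unfolding schur_geometric times_divide_eq_right[symmetric]
    by (intro tendsto_intros tendsto_prod sinh_quotient_limit) auto
  then show ?thesis unfolding eqw[symmetric] by simp
qed

text \<open>With q = exp w the progression q^(n-1), ..., 1 is the case b = n - 1; near 1 the inverse
  substitution is w = Ln q.\<close>

lemma schur_one_eq_weyl_dim: "schur_one n l = weyl_dim n l"
proof -
  let ?b = "of_nat n - 1 :: complex"
  define G where "G = (\<lambda>w. schur l (map exp (map (\<lambda>i. w * (?b - of_nat i)) [0..<n])))"
  have lim: "(G \<longlongrightarrow> weyl_dim n l) (at 0)"
    unfolding G_def by (rule schur_geometric_limit)
  have "((\<lambda>q. schur l (map (\<lambda>i. q ^ (n - 1 - i)) [0..<n])) \<longlongrightarrow> weyl_dim n l) (at (1::complex))"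
  proof (rule Lim_transform_eventually)
    have "filterlim Ln (at 0) (at (1::complex))"
    proof (rule filterlim_atI)
      show "(Ln \<longlongrightarrow> 0) (at (1::complex))"
        using continuous_at_Ln[of 1] by (simp add: isCont_def)
      have "\<forall>\<^sub>F q in at (1::complex). q \<in> - {0}"
        by (rule eventually_at_in_open') auto
      then show "\<forall>\<^sub>F q in at (1::complex). Ln q \<noteq> 0"
        using eventually_neq_at_within[of 1 1 UNIV]
        by eventually_elim (metis ComplD exp_Ln exp_zero singletonI)
    qed
    then show "((\<lambda>q. G (Ln q)) \<longlongrightarrow> weyl_dim n l) (at 1)"
      by (rule filterlim_compose[OF lim])
    have "\<forall>\<^sub>F q in at (1::complex). q \<in> - {0}"
      by (rule eventually_at_in_open') auto
    then show "\<forall>\<^sub>F q in at 1. G (Ln q) = schur l (map (\<lambda>i. q ^ (n - 1 - i)) [0..<n])"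
    proof eventually_elim
      case (elim q)
      have "exp (Ln q * (?b - of_nat i)) = q ^ (n - 1 - i)" if "i < n" for i
      proof -
        have "?b - of_nat i = of_nat (n - 1 - i)" using that by (simp add: of_nat_diff)
        then show ?thesis using elim by (simp add: mult.commute[of "Ln q"] exp_of_nat_mult)
      qed
      then show ?case unfolding G_def map_map o_def
        by (intro arg_cong[of _ _ "schur l"] map_cong) auto
    qed
  qed
  then show ?thesis unfolding schur_one_def by (intro tendsto_Lim) auto
qed

text \<open>sinh is convex on the half-line and vanishes at 0, hence sinh x / x is
  increasing.\<close>

lemma real_sinh_quotient_mono:
  fixes x y :: real
  assumes "0 < x" "x \<le> y"
  shows "y * sinh x \<le> x * sinh y"
proof -
  have "convex_on {0..} (sinh :: real \<Rightarrow> real)"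
    by (rule f''_ge0_imp_convex[where f' = cosh and f'' = sinh])
       (auto intro!: derivative_eq_intros)
  then have "sinh ((1 - x / y) *\<^sub>R 0 + (x / y) *\<^sub>R y) \<le> (1 - x / y) * sinh 0 + (x / y) * sinh y"
    using assms by (intro convex_onD) auto
  then show ?thesis using assms by (simp add: field_simps)
qed

lemma real_le_sinh: "0 \<le> x \<Longrightarrow> x \<le> sinh x" for x :: real
proof -
  assume "0 \<le> x"
  then have "sinh 0 - 0 \<le> sinh x - x"
    by (rule DERIV_nonneg_imp_nondecreasing[where f = "\<lambda>x. sinh x - x"])
       (auto intro!: derivative_eq_intros exI simp: cosh_real_ge_1)
  then show ?thesis by simp
qed

text \<open>Both bounds use that sinh x / x is increasing. For the upper one, sinh (e b) is first
  replaced by e b, then e by e0; restoring sinh (e0 b) costs a factor depending on \<open>b\<close>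
  and \<open>e0\<close> but not on \<open>a\<close>, that is, not on the signature.\<close>

lemma sinh_ratio_bounds:
  fixes a b e e0 :: real
  assumes "0 < b" "b \<le> a" "0 < e" "e \<le> e0"
  shows "1 \<le> sinh (e * a) / sinh (e * b) / (a / b)"
    and "sinh (e * a) / sinh (e * b) / (a / b) \<le>
      sinh (e0 * b) / (e0 * b) * (sinh (e0 * a) / sinh (e0 * b) / (a / b))"
proof -
  have pos: "sinh (e * b) > 0" "sinh (e0 * b) > 0" "a > 0" "e0 > 0" using assms by auto
  have "(e * a) * sinh (e * b) \<le> (e * b) * sinh (e * a)"
    using assms by (intro real_sinh_quotient_mono) auto
  then have "e * (a * sinh (e * b)) \<le> e * (b * sinh (e * a))" by (simp add: mult_ac)
  then have "a * sinh (e * b) \<le> b * sinh (e * a)" using assms by simp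
  then show "1 \<le> sinh (e * a) / sinh (e * b) / (a / b)"
    using pos assms by (simp add: field_simps)
  have "e * b \<le> sinh (e * b)" using assms by (intro real_le_sinh) auto
  then have "sinh (e * a) / sinh (e * b) \<le> sinh (e * a) / (e * b)"
    using assms pos by (intro divide_left_mono) auto
  also have "\<dots> \<le> sinh (e0 * a) / (e0 * b)"
  proof -
    have "(e0 * a) * sinh (e * a) \<le> (e * a) * sinh (e0 * a)"
      using assms by (intro real_sinh_quotient_mono) auto
    then have "a * (e0 * sinh (e * a)) \<le> a * (e * sinh (e0 * a))" by (simp add: mult_ac)
    then have "e0 * sinh (e * a) \<le> e * sinh (e0 * a)" using pos by simp
    then show ?thesis using assms pos by (simp add: field_simps)
  qed
  finally have "sinh (e * a) / sinh (e * b) / (a / b) \<le> sinh (e0 * a) / (e0 * b) / (a / b)"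
    using assms by (intro divide_right_mono) auto
  also have "\<dots> = sinh (e0 * b) / (e0 * b) * (sinh (e0 * a) / sinh (e0 * b) / (a / b))"
    using pos by (simp add: field_simps)
  finally show "sinh (e * a) / sinh (e * b) / (a / b) \<le>
      sinh (e0 * b) / (e0 * b) * (sinh (e0 * a) / sinh (e0 * b) / (a / b))" .
qed

text \<open>The centring makes the exponential factor of \<open>schur_geometric\<close> equal to 1,
  which leaves real quotients of sinh.\<close>

definition central_point :: "nat \<Rightarrow> real \<Rightarrow> complex list" where
  "central_point n e = map (\<lambda>i. of_real e * ((of_nat n - 1) / 2 - of_nat i)) [0..<n]"

lemma sinh_of_real: "sinh (of_real x :: complex) = of_real (sinh x)"
  by (simp add: sinh_def scaleR_conv_of_real exp_of_real flip: of_real_minus)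

text \<open>Numerators and denominators keep their halves so that each factor has literally the form
  bounded in \<open>sinh_ratio_bounds\<close>.\<close>

lemma schur_ratio_central_point:
  "schur_ratio n l (central_point n e) = of_real (\<Prod>i<n. \<Prod>j\<in>{i<..<n}.
     sinh (e * ((l ! i - l ! j + int j - int i) / 2)) / sinh (e * ((real j - real i) / 2)) /
     (((l ! i - l ! j + int j - int i) / 2) / ((real j - real i) / 2)))"
proof -
  have *: "sinh (of_real e * of_real x / 2) / sinh (of_real e * of_real y / 2) / (of_real x / of_real y) =
      complex_of_real (sinh (e * (x / 2)) / sinh (e * (y / 2)) / ((x / 2) / (y / 2)))" for x y
    by (simp flip: sinh_of_real)
  show ?thesis
    unfolding schur_ratio_def central_point_def schur_geometric schur_one_eq_weyl_dim weyl_dim_def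
      of_real_prod *[symmetric]
    by (simp flip: prod_dividef add: shifted_part_def algebra_simps)
qed

lemma signature_gap:
  assumes "l \<in> signatures n" "i < j" "j < n"
  shows "real j - real i \<le> of_int (l ! i - l ! j + int j - int i)"
proof -
  have "l ! j \<le> l ! i"
    using assms sorted_wrt_nth_less[of "(\<ge>)" l i j] by (auto simp: signatures_def)
  then show ?thesis by simp
qed

text \<open>Yields integrability of the bare moment: it is dominated by its product with this
  ratio.\<close>

lemma norm_schur_ratio_central_point_ge_1:
  assumes "l \<in> signatures n" "0 < e"
  shows "1 \<le> norm (schur_ratio n l (central_point n e))"
proof -
  have "1 \<le> (\<Prod>i<n. \<Prod>j\<in>{i<..<n}.
     sinh (e * ((l ! i - l ! j + int j - int i) / 2)) / sinh (e * ((real j - real i) / 2)) /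
     (((l ! i - l ! j + int j - int i) / 2) / ((real j - real i) / 2)))"
    using assms(2) signature_gap[OF assms(1)]
    by (intro prod_ge_1 sinh_ratio_bounds(1)[where e0 = e]) (auto simp: divide_right_mono)
  then show ?thesis unfolding schur_ratio_central_point norm_of_real by linarith
qed

text \<open>The constant is independent of \<open>l\<close>, so one dominating function serves all
  \<open>e\<close> in (0, e0].\<close>

lemma norm_schur_ratio_central_point_le:
  assumes "l \<in> signatures n" "0 < e" "e \<le> e0"
  shows "norm (schur_ratio n l (central_point n e)) \<le>
     (\<Prod>i<n. \<Prod>j\<in>{i<..<n}. sinh (e0 * ((real j - real i) / 2)) / (e0 * ((real j - real i) / 2))) *
     norm (schur_ratio n l (central_point n e0))"
proof -
  let ?f = "\<lambda>e i j. sinh (e * ((l ! i - l ! j + int j - int i) / 2)) / sinh (e * ((real j - real i) / 2)) /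
     (((l ! i - l ! j + int j - int i) / 2) / ((real j - real i) / 2))"
  have 1: "1 \<le> ?f e i j" if "i < j" "j < n" "e > 0" for e i j
    using that signature_gap[OF assms(1), of i j]
    by (intro sinh_ratio_bounds(1)[where e0 = e]) (auto simp: divide_right_mono)
  have pos: "0 \<le> (\<Prod>i<n. \<Prod>j\<in>{i<..<n}. ?f e i j)" if "e > 0" for e
    using 1[OF _ _ that] by (intro prod_nonneg ballI) (force intro: order_trans[of 0 1])
  have "(\<Prod>i<n. \<Prod>j\<in>{i<..<n}. ?f e i j) \<le> (\<Prod>i<n. \<Prod>j\<in>{i<..<n}.
      sinh (e0 * ((real j - real i) / 2)) / (e0 * ((real j - real i) / 2)) * ?f e0 i j)"
  proof (intro prod_mono conjI prod_nonneg)
    fix i j assume "j \<in> {i<..<n}"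
    then show "?f e i j \<le> sinh (e0 * ((real j - real i) / 2)) / (e0 * ((real j - real i) / 2)) * ?f e0 i j"
      using assms(2,3) signature_gap[OF assms(1), of i j]
      by (intro sinh_ratio_bounds(2)) (auto simp: divide_right_mono)
  qed (use 1 assms in \<open>force intro: order_trans[of 0 1]\<close>)+
  then show ?thesis
    using pos[of e] pos[of e0] assms unfolding schur_ratio_central_point norm_of_real prod.distrib
    by (simp only: abs_of_nonneg)
qed

section \<open>Difference operators\<close>

text \<open>The quotient of Vandermonde products with and without the translation of the j-th coordinate.\<close>

definition shift_coeff :: "complex \<Rightarrow> complex list \<Rightarrow> nat \<Rightarrow> complex" where
  "shift_coeff a z j =
     (\<Prod>m\<in>{..<length z} - {j}. (exp (z ! j + a) - exp (z ! m)) / (exp (z ! j) - exp (z ! m)))"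

text \<open>The leftmost operator carries \<open>c 0\<close>: its translation is performed first,
  matching the innermost contour.\<close>

fun shift_op :: "nat \<Rightarrow> (nat \<Rightarrow> complex) \<Rightarrow> (complex list \<Rightarrow> complex) \<Rightarrow> complex list \<Rightarrow> complex" where
  "shift_op 0 c f z = f z"
| "shift_op (Suc k) c f z =
     (\<Sum>j<length z. shift_coeff (c 0) z j * shift_op k (\<lambda>i. c (Suc i)) f (z[j := z ! j + c 0]))"

text \<open>Used with distinctness of the exponentials and with membership in
  \<open>\<Omega>\<close>^N, the two conditions under which \<open>S\<close> is an
  expectation.\<close>

fun shift_all :: "nat \<Rightarrow> (nat \<Rightarrow> complex) \<Rightarrow> (complex list \<Rightarrow> bool) \<Rightarrow> complex list \<Rightarrow> bool" where
  "shift_all 0 c P z = P z"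
| "shift_all (Suc k) c P z =
     (P z \<and> (\<forall>j<length z. shift_all k (\<lambda>i. c (Suc i)) P (z[j := z ! j + c 0])))"

lemma shift_all_base: "shift_all k c P z \<Longrightarrow> P z"
  by (cases k) auto

lemma shift_all_conj: "shift_all k c P z \<Longrightarrow> shift_all k c Q z \<Longrightarrow> shift_all k c (\<lambda>z. P z \<and> Q z) z"
  by (induction k arbitrary: c z) auto

lemma shift_op_expectation:
  fixes p :: "'a pmf"
  assumes "\<And>z. P z \<Longrightarrow> integrable (measure_pmf p) (\<lambda>l. f l z) \<and> S z = measure_pmf.expectation p (\<lambda>l. f l z)"
    and "shift_all k c P z"
  shows "integrable (measure_pmf p) (\<lambda>l. shift_op k c (f l) z) \<and>
    shift_op k c S z = measure_pmf.expectation p (\<lambda>l. shift_op k c (f l) z)"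
  using assms(2)
  by (induction k arbitrary: c z) (use assms(1) in \<open>auto intro!: sum.cong\<close>)

text \<open>Translating one coordinate affects only the pairs that contain \<open>j\<close>;
  symmetry of \<open>r\<close> allows each of them to be written with \<open>j\<close>
  first.\<close>

lemma prod_pairs_single:
  fixes r :: "nat \<Rightarrow> nat \<Rightarrow> 'a::comm_monoid_mult"
  assumes "j < n" and sym: "\<And>i m. r i m = r m i" and one: "\<And>i m. i \<noteq> j \<Longrightarrow> m \<noteq> j \<Longrightarrow> r i m = 1"
  shows "(\<Prod>i<n. \<Prod>m\<in>{i<..<n}. r i m) = (\<Prod>m\<in>{..<n} - {j}. r j m)"
proof -
  let ?P = "SIGMA i:{..<n}. {i<..<n}"
  have "(\<Prod>i<n. \<Prod>m\<in>{i<..<n}. r i m) = (\<Prod>(i,m)\<in>?P. r i m)"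
    by (rule prod.Sigma) auto
  also have "\<dots> = (\<Prod>(i,m)\<in>{(i,m)\<in>?P. i = j \<or> m = j}. r i m)"
    by (rule prod.mono_neutral_right) (auto, metis one)
  also have "\<dots> = (\<Prod>m\<in>{..<n} - {j}. r j m)"
    by (rule prod.reindex_bij_witness[of _ "\<lambda>m. (min m j, max m j)" "\<lambda>(i, m). if i = j then m else i"])
       (use assms in \<open>auto simp: min_def max_def\<close>)
  finally show ?thesis .
qed

lemma exp_distinct_iff:
  "exp_distinct z \<longleftrightarrow> (\<forall>i<length z. \<forall>m<length z. i \<noteq> m \<longrightarrow> exp (z ! i) \<noteq> exp (z ! m))"
  by (auto simp: exp_distinct_def distinct_conv_nth)

lemma vandermonde_shift:
  assumes "exp_distinct z" "j < length z"
  shows "vandermonde (map exp (z[j := z ! j + a])) = shift_coeff a z j * vandermonde (map exp z)"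
    and "vandermonde (map exp z) \<noteq> 0"
proof -
  let ?n = "length z"
  define x' where "x' = (\<lambda>i. if i = j then z ! j + a else z ! i)"
  define r where "r = (\<lambda>i m. if i = m then 1 else if i = j \<or> m = j then
    (exp (x' i) - exp (x' m)) / (exp (z ! i) - exp (z ! m)) else 1)"
  have ne: "exp (z ! i) - exp (z ! m) \<noteq> 0" if "i < ?n" "m < ?n" "i \<noteq> m" for i m
    using assms that by (auto simp: exp_distinct_iff)
  show "vandermonde (map exp z) \<noteq> 0"
    unfolding vandermonde_exp[OF refl] using ne by (auto simp: prod_zero_iff)
  have "vandermonde (map exp (z[j := z ! j + a])) =
      (\<Prod>i<?n. \<Prod>m\<in>{i<..<?n}. r i m * (exp (z ! i) - exp (z ! m)))"
    unfolding vandermonde_exp[of "z[j := z ! j + a]" ?n, simplified]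
    using ne by (intro prod.cong refl) (auto simp: r_def x'_def nth_list_update)
  also have "\<dots> = (\<Prod>i<?n. \<Prod>m\<in>{i<..<?n}. r i m) * vandermonde (map exp z)"
    by (simp add: prod.distrib vandermonde_exp)
  also have "(\<Prod>i<?n. \<Prod>m\<in>{i<..<?n}. r i m) = (\<Prod>m\<in>{..<?n} - {j}. r j m)"
  proof (rule prod_pairs_single[OF assms(2)])
    fix i m
    have "(a - b) / (c - d) = (b - a) / (d - c)" for a b c d :: complex
      by (metis minus_diff_eq minus_divide_divide)
    then show "r i m = r m i" by (auto simp: r_def)
  qed (auto simp: r_def)
  also have "\<dots> = shift_coeff a z j"
    unfolding shift_coeff_def by (intro prod.cong) (auto simp: r_def x'_def)
  finally show "vandermonde (map exp (z[j := z ! j + a])) = shift_coeff a z j * vandermonde (map exp z)" .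
qed

text \<open>The translation multiplies the term of sigma by exp (a L_(sigma j)). Summed over j this
  factor is the same for every sigma, because sigma permutes the indices.\<close>

lemma schur_det_shift_sum:
  "(\<Sum>j<length z. schur_det l (map exp (z[j := z ! j + a]))) =
   (\<Sum>j<length z. exp (a * shifted_part (length z) l j)) * schur_det l (map exp z)"
proof -
  let ?n = "length z" and ?L = "shifted_part (length z) l"
  have fac: "(\<Prod>i<?n. exp (z[j := z ! j + a] ! i * ?L (\<sigma> i))) =
      exp (a * ?L (\<sigma> j)) * (\<Prod>i<?n. exp (z ! i * ?L (\<sigma> i)))" if "j < ?n" for j \<sigma>
  proof -
    have "(\<Prod>i<?n. exp (z[j := z ! j + a] ! i * ?L (\<sigma> i))) =
       (\<Prod>i<?n. (if i = j then exp (a * ?L (\<sigma> i)) else 1) * exp (z ! i * ?L (\<sigma> i)))"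
      by (intro prod.cong refl) (auto simp: nth_list_update exp_add[symmetric] algebra_simps)
    then show ?thesis using that by (simp add: prod.distrib)
  qed
  have perm: "(\<Sum>j<?n. exp (a * ?L (\<sigma> j))) = (\<Sum>j<?n. exp (a * ?L j))" if "\<sigma> permutes {..<?n}" for \<sigma>
    using sum.permute[OF that, of "\<lambda>j. exp (a * ?L j)"] by (simp add: o_def)
  have "(\<Sum>j<?n. schur_det l (map exp (z[j := z ! j + a]))) =
    (\<Sum>j<?n. \<Sum>\<sigma> | \<sigma> permutes {..<?n}. exp (a * ?L (\<sigma> j)) *
      (of_int (sign \<sigma>) * (\<Prod>i<?n. exp (z ! i * ?L (\<sigma> i)))))"
    using fac by (intro sum.cong refl, subst schur_det_exp[of _ ?n]) (auto intro!: sum.cong)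
  also have "\<dots> = (\<Sum>\<sigma> | \<sigma> permutes {..<?n}. \<Sum>j<?n. exp (a * ?L (\<sigma> j)) *
      (of_int (sign \<sigma>) * (\<Prod>i<?n. exp (z ! i * ?L (\<sigma> i)))))"
    by (rule sum.swap)
  also have "\<dots> = (\<Sum>\<sigma> | \<sigma> permutes {..<?n}. (\<Sum>j<?n. exp (a * ?L j)) *
      (of_int (sign \<sigma>) * (\<Prod>i<?n. exp (z ! i * ?L (\<sigma> i)))))"
    using perm by (intro sum.cong refl) (simp add: sum_distrib_right[symmetric])
  also have "\<dots> = (\<Sum>j<?n. exp (a * ?L j)) * schur_det l (map exp z)"
    by (simp add: schur_det_exp[OF refl] sum_distrib_left)
  finally show ?thesis .
qed

text \<open>Distinctness is required after the translation as well: where exponentials coincide,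
  \<open>schur\<close> divides by 0 and has the default value 0 instead of the value of the Laurent
  polynomial.\<close>

lemma schur_ratio_shift_sum:
  assumes "exp_distinct z" "\<And>j. j < length z \<Longrightarrow> exp_distinct (z[j := z ! j + a])"
  shows "(\<Sum>j<length z. shift_coeff a z j * schur_ratio n l (z[j := z ! j + a])) =
    (\<Sum>j<length z. exp (a * shifted_part (length z) l j)) * schur_ratio n l z"
proof -
  have "shift_coeff a z j * schur_ratio n l (z[j := z ! j + a]) =
      schur_det l (map exp (z[j := z ! j + a])) / (vandermonde (map exp z) * schur_one n l)"
    if j: "j < length z" for j
  proof -
    have "vandermonde (map exp (z[j := z ! j + a])) \<noteq> 0"
      using vandermonde_shift(2)[OF assms(2)[OF j]] j by simp
    then show ?thesis
      using vandermonde_shift(1)[OF assms(1) j, of a] vandermonde_shift(2)[OF assms(1) j]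
      by (auto simp: schur_ratio_def schur_def)
  qed
  then show ?thesis
    by (simp add: sum_divide_distrib[symmetric] schur_det_shift_sum schur_ratio_def schur_def)
qed

lemma shift_op_schur_ratio:
  assumes "shift_all k c exp_distinct z"
  shows "shift_op k c (schur_ratio n l) z =
    (\<Prod>i<k. \<Sum>j<length z. exp (c i * shifted_part (length z) l j)) * schur_ratio n l z"
  using assms
proof (induction k arbitrary: c z)
  case (Suc k)
  let ?Q = "\<Prod>i<k. \<Sum>j<length z. exp (c (Suc i) * shifted_part (length z) l j)"
  have "shift_op (Suc k) c (schur_ratio n l) z =
     (\<Sum>j<length z. ?Q * (shift_coeff (c 0) z j * schur_ratio n l (z[j := z ! j + c 0])))"
    using Suc by (auto intro!: sum.cong simp: mult_ac)
  also have "\<dots> = ?Q * ((\<Sum>j<length z. exp (c 0 * shifted_part (length z) l j)) * schur_ratio n l z)"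
    unfolding sum_distrib_left[symmetric] using Suc.prems
    by (subst schur_ratio_shift_sum) (auto dest: shift_all_base)
  finally show ?case by (simp add: prod.lessThan_Suc_shift mult_ac del: prod.lessThan_Suc shift_op.simps)
qed simp

section \<open>The integrand\<close>

definition pole_factor :: "complex \<Rightarrow> complex \<Rightarrow> complex \<Rightarrow> complex" where
  "pole_factor u a z = (exp (u + a) - exp z) / (exp u - exp z)"

definition cross_factor :: "complex \<Rightarrow> complex \<Rightarrow> complex \<Rightarrow> complex \<Rightarrow> complex" where
  "cross_factor u a v b = ((exp (v + b) - exp (u + a)) * (exp v - exp u)) /
     ((exp v - exp (u + a)) * (exp (v + b) - exp u))"

text \<open>The identity behind the induction: taking a residue at u moves the point u to u + a in
  the pole factor of the remaining variable v.\<close>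

lemma cross_factor_mult_pole_factor:
  assumes "exp v \<noteq> exp u" "exp (v + b) \<noteq> exp u"
  shows "cross_factor u a v b * pole_factor v b u = pole_factor v b (u + a)"
  using assms by (simp add: cross_factor_def pole_factor_def)

definition lift_integrand ::
  "(nat \<Rightarrow> complex list \<Rightarrow> complex list \<Rightarrow> complex) \<Rightarrow> nat \<Rightarrow> (nat \<Rightarrow> complex) \<Rightarrow> complex list \<Rightarrow>
   (nat \<Rightarrow> complex) \<Rightarrow> complex" where
  "lift_integrand St k c z u =
     St k (map (\<lambda>i. u i + c i) [0..<k] @ z) (map u [0..<k]) *
     (\<Prod>i<k. \<Prod>j\<in>{i<..<k}. cross_factor (u i) (c i) (u j) (c j)) *
     (\<Prod>i<k. (\<Prod>m<length z. pole_factor (u i) (c i) (z ! m)) / (exp (c i) - 1))"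

lemma lift_integrand_Suc:
  "lift_integrand St (Suc k) c z (case_nat t v) =
     St (Suc k) ((t + c 0) # map (\<lambda>i. v i + c (Suc i)) [0..<k] @ z) (t # map v [0..<k]) *
     (\<Prod>j<k. cross_factor t (c 0) (v j) (c (Suc j))) *
     (\<Prod>i<k. \<Prod>j\<in>{i<..<k}. cross_factor (v i) (c (Suc i)) (v j) (c (Suc j))) *
     ((\<Prod>m<length z. pole_factor t (c 0) (z ! m)) / (exp (c 0) - 1) *
     (\<Prod>i<k. (\<Prod>m<length z. pole_factor (v i) (c (Suc i)) (z ! m)) / (exp (c (Suc i)) - 1)))"
proof -
  have upt: "[0..<Suc k] = 0 # map Suc [0..<k]"
    by (simp add: upt_conv_Cons map_Suc_upt del: upt_Suc)
  have "{0<..<Suc k} = Suc ` {..<k}" "{Suc i<..<Suc k} = Suc ` {i<..<k}" for i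
    by (auto simp: image_iff less_Suc_eq_0_disj)
  then have "(\<Prod>j\<in>{0<..<Suc k}. f j) = (\<Prod>j<k. f (Suc j))"
    "(\<Prod>j\<in>{Suc i<..<Suc k}. f j) = (\<Prod>j\<in>{i<..<k}. f (Suc j))" for f :: "nat \<Rightarrow> complex" and i
    by (simp_all add: prod.reindex)
  then show ?thesis
    unfolding lift_integrand_def upt by (simp add: prod.lessThan_Suc_shift o_def del: prod.lessThan_Suc)
qed

text \<open>Continuity in \<open>analytic_lists\<close> is stated along sequences, which is why the
  parameter space is metric; the space of functions on the naturals is one by its product
  metric.\<close>

lemma analytic_lists_continuous:
  fixes \<phi> :: "'x::metric_space \<Rightarrow> complex list"
  assumes "analytic_lists A n f" "\<And>x. x \<in> P \<Longrightarrow> \<phi> x \<in> points A n"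
    and "\<And>i. i < n \<Longrightarrow> continuous_on P (\<lambda>x. \<phi> x ! i)"
  shows "continuous_on P (\<lambda>x. f (\<phi> x))"
  unfolding continuous_on_sequentially o_def
proof (intro allI ballI impI)
  fix x a assume a: "a \<in> P" and x: "(\<forall>n. x n \<in> P) \<and> x \<longlonglongrightarrow> a"
  have "(\<lambda>j. \<phi> (x j) ! i) \<longlonglongrightarrow> \<phi> a ! i" if "i < n" for i
    using assms(3)[OF that] a x unfolding continuous_on_sequentially o_def by blast
  then show "(\<lambda>j. f (\<phi> (x j))) \<longlonglongrightarrow> f (\<phi> a)"
    using assms(2) a x
    by (intro assms(1)[unfolded analytic_lists_def, THEN conjunct2, rule_format]) auto
qed

lemma points_list_update: "z \<in> points A n \<Longrightarrow> t \<in> A \<Longrightarrow> z[i := t] \<in> points A n"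
  by (auto simp: points_def dest!: set_update_subset_insert[THEN subsetD])

text \<open>An integration variable enters a lift twice, as t + a among the x and as t among the y;
  holomorphy in t is an instance of the diagonal lemma.\<close>

lemma analytic_lists_holomorphic_two:
  assumes an: "analytic_lists A n f" and z: "z \<in> points A n" and ij: "i < n" "j < n" "i \<noteq> j"
    and W: "open W" "W \<subseteq> A" "(\<lambda>t. t + a) ` W \<subseteq> A"
  shows "(\<lambda>t. f (z[i := t + a, j := t])) holomorphic_on W"
proof (rule holomorphic_on_diagonal[where f = "\<lambda>s t. f (z[i := s + a, j := t])"])
  have hol: "\<And>z i. z \<in> points A n \<Longrightarrow> i < n \<Longrightarrow> (\<lambda>t. f (z[i := t])) holomorphic_on A"
    using an unfolding analytic_lists_def by blast
  have len: "length z = n" using z by (simp add: points_def)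
  have "continuous_on (W \<times> W) (\<lambda>y. f (z[i := fst y + a, j := snd y]))"
  proof (rule analytic_lists_continuous[OF an])
    show "z[i := fst y + a, j := snd y] \<in> points A n" if "y \<in> W \<times> W" for y
      using that W z by (intro points_list_update) auto
    show "continuous_on (W \<times> W) (\<lambda>y. z[i := fst y + a, j := snd y] ! m)" if "m < n" for m
      using that ij len
      by (cases "m = j"; cases "m = i") (auto intro!: continuous_intros)
  qed
  then show "continuous_on (W \<times> W) (\<lambda>(s, t). f (z[i := s + a, j := t]))"
    by (simp add: case_prod_unfold)
  show "(\<lambda>s. f (z[i := s + a, j := t])) holomorphic_on W" if t: "t \<in> W" for t
  proof -
    have "(\<lambda>x. f (z[j := t, i := x])) holomorphic_on A"
      using t W z ij by (intro hol points_list_update) auto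
    then have "(\<lambda>x. f (z[j := t, i := x])) \<circ> (\<lambda>s. s + a) holomorphic_on W"
      by (rule holomorphic_on_compose_gen[rotated]) (use W(3) in \<open>auto intro: holomorphic_intros\<close>)
    then have "(\<lambda>s. f (z[j := t, i := s + a])) holomorphic_on W" by (simp add: o_def)
    then show ?thesis using ij by (simp add: list_update_swap)
  qed
  show "(\<lambda>t. f (z[i := s + a, j := t])) holomorphic_on W" if s: "s \<in> W" for s
    using s W z ij by (intro holomorphic_on_subset[OF hol] points_list_update) auto
qed fact

lemma holomorphic_on_fun_upd: "(\<lambda>t. (u(i := t)) j) holomorphic_on W"
  by (cases "i = j") auto

lemma supersymmetric_lift_holomorphic:
  assumes lift: "supersymmetric_lift \<Omega> N S St" and z: "z \<in> points \<Omega> N" and i: "i < k"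
    and u: "\<And>j. j < k \<Longrightarrow> j \<noteq> i \<Longrightarrow> u j \<in> \<Omega> \<and> u j + c j \<in> \<Omega>"
    and W: "open W" "W \<subseteq> \<Omega>" "(\<lambda>t. t + c i) ` W \<subseteq> \<Omega>"
  shows "(\<lambda>t. St k (map (\<lambda>j. (u(i := t)) j + c j) [0..<k] @ z) (map (u(i := t)) [0..<k])) holomorphic_on W"
proof -
  have lz: "length z = N" using z by (simp add: points_def)
  show "(\<lambda>t. St k (map (\<lambda>j. (u(i := t)) j + c j) [0..<k] @ z) (map (u(i := t)) [0..<k])) holomorphic_on W"
  proof (cases "W = {}")
    case False
    then obtain w where w: "w \<in> W" by auto
    define v where "v = map (\<lambda>j. (u(i := w)) j + c j) [0..<k] @ z @ map (u(i := w)) [0..<k]"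
    have v: "v \<in> points \<Omega> (N + k + k)"
      using z u w W by (auto simp: v_def points_def)
    have an: "analytic_lists \<Omega> (N + k + k) (\<lambda>v. St k (take (N + k) v) (drop (N + k) v))"
      using lift by (simp add: supersymmetric_lift_def)
    \<comment> \<open>The list consists of k translated variables, the N entries of \<open>z\<close>
      and k untranslated variables, hence position \<open>N + k + i\<close> for the second
      occurrence. The auxiliary value \<open>w\<close> is overwritten in both places.\<close>
    have eq: "v[i := t + c i, N + k + i := t] =
       (map (\<lambda>j. (u(i := t)) j + c j) [0..<k] @ z) @ map (u(i := t)) [0..<k]" for t
      by (rule nth_equalityI) (use i lz in \<open>auto simp: v_def nth_append nth_list_update\<close>)
    have "(\<lambda>t. St k (take (N + k) (v[i := t + c i, N + k + i := t]))
        (drop (N + k) (v[i := t + c i, N + k + i := t]))) holomorphic_on W"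
      using i W by (intro analytic_lists_holomorphic_two[OF an v]) auto
    then show ?thesis unfolding eq using lz by simp
  qed (simp add: holomorphic_on_def)
qed

lemma lift_integrand_holomorphic:
  assumes lift: "supersymmetric_lift \<Omega> N S St" and z: "z \<in> points \<Omega> N" and i: "i < k"
    and u: "\<And>j. j < k \<Longrightarrow> j \<noteq> i \<Longrightarrow> u j \<in> \<Omega> \<and> u j + c j \<in> \<Omega>"
    and W: "open W" "W \<subseteq> \<Omega>" "(\<lambda>t. t + c i) ` W \<subseteq> \<Omega>"
    and cnz: "\<And>j. j < k \<Longrightarrow> exp (c j) \<noteq> 1"
    and cross: "\<And>t a b. t \<in> W \<Longrightarrow> a < b \<Longrightarrow> b < k \<Longrightarrow>
       exp ((u(i := t)) b) \<noteq> exp ((u(i := t)) a + c a) \<and> exp ((u(i := t)) b + c b) \<noteq> exp ((u(i := t)) a)"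
    and pole: "\<And>t a m. t \<in> W \<Longrightarrow> a < k \<Longrightarrow> m < N \<Longrightarrow> exp ((u(i := t)) a) \<noteq> exp (z ! m)"
  shows "(\<lambda>t. lift_integrand St k c z (u(i := t))) holomorphic_on W"
proof -
  have lz: "length z = N" using z by (simp add: points_def)
  have St: "(\<lambda>t. St k (map (\<lambda>j. (u(i := t)) j + c j) [0..<k] @ z) (map (u(i := t)) [0..<k])) holomorphic_on W"
    by (rule supersymmetric_lift_holomorphic[OF lift z i _ W(1,2)]) (use u W(3) in auto)
  have pf: "(\<lambda>t. pole_factor ((u(i := t)) j) (c j) (z ! m)) holomorphic_on W" if "j < k" "m < N" for j m
    unfolding pole_factor_def using pole[OF _ that]
    by (intro holomorphic_on_divide holomorphic_on_diff holomorphic_on_exp' holomorphic_on_add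
        holomorphic_on_const holomorphic_on_fun_upd) auto
  have cf: "(\<lambda>t. cross_factor ((u(i := t)) j) (c j) ((u(i := t)) m) (c m)) holomorphic_on W"
    if "j < m" "m < k" for j m
    unfolding cross_factor_def using cross[OF _ that]
    by (intro holomorphic_on_divide holomorphic_on_mult holomorphic_on_diff holomorphic_on_exp'
        holomorphic_on_add holomorphic_on_const holomorphic_on_fun_upd) auto
  show "(\<lambda>t. lift_integrand St k c z (u(i := t))) holomorphic_on W"
    unfolding lift_integrand_def lz using cnz
    by (intro holomorphic_on_mult holomorphic_on_prod holomorphic_on_divide holomorphic_on_const
        St pf cf) auto
qed

text \<open>By compactness, finitely many open relations between compact sets persist on
  d-neighbourhoods with a common d. This provides product domains on which no denominator of the
  integrand vanishes.\<close>

lemma compact_pairwise_neighbourhoods: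
  fixes K :: "nat \<Rightarrow> 'a::metric_space set"
  assumes K: "\<And>i. i < n \<Longrightarrow> compact (K i)"
    and R: "\<And>i j. i < n \<Longrightarrow> j < n \<Longrightarrow> open (R i j)" "\<And>i j. i < n \<Longrightarrow> j < n \<Longrightarrow> K i \<times> K j \<subseteq> R i j"
  obtains d where "d > 0"
    "\<And>i j x y. i < n \<Longrightarrow> j < n \<Longrightarrow> x \<in> (\<Union>a\<in>K i. ball a d) \<Longrightarrow> y \<in> (\<Union>a\<in>K j. ball a d) \<Longrightarrow> (x, y) \<in> R i j"
proof -
  let ?P = "\<lambda>i j d. \<forall>x\<in>(\<Union>a\<in>K i. ball a d). \<forall>y\<in>(\<Union>a\<in>K j. ball a d). (x, y) \<in> R i j"
  have ev: "eventually (?P i j) (at_right 0)" if ij: "i < n" "j < n" for i j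
  proof -
    obtain e where e: "e > 0" "(\<Union>p\<in>K i \<times> K j. ball p e) \<subseteq> R i j"
      using compact_subset_open_imp_ball_epsilon_subset[OF compact_Times R(1) R(2)] K ij by metis
    have "?P i j d" if "d < e / 2" for d
    proof (clarify)
      fix x y a b assume ab: "a \<in> K i" "b \<in> K j" "x \<in> ball a d" "y \<in> ball b d"
      have "dist (a, b) (x, y) \<le> dist a x + dist b y"
        unfolding dist_Pair_Pair by (rule sqrt_sum_squares_le_sum) auto
      then have "(x, y) \<in> ball (a, b) e" using ab that by simp
      then show "(x, y) \<in> R i j" using e(2) ab by blast
    qed
    then show ?thesis
      using e(1) by (intro eventually_at_rightI[of 0 "e / 2"]) (auto simp only: greaterThanLessThan_iff)
  qed
  have "\<forall>\<^sub>F d in at_right 0. \<forall>i\<in>{..<n}. \<forall>j\<in>{..<n}. ?P i j d"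
    using ev by (intro eventually_ball_finite ballI) auto
  moreover have "\<forall>\<^sub>F d::real in at_right 0. 0 < d"
    by (rule eventually_at_right_less)
  ultimately have "\<forall>\<^sub>F d in at_right 0. 0 < d \<and> (\<forall>i\<in>{..<n}. \<forall>j\<in>{..<n}. ?P i j d)"
    by eventually_elim simp
  then obtain d where "0 < d" "\<forall>i\<in>{..<n}. \<forall>j\<in>{..<n}. ?P i j d"
    using eventually_happens'[OF trivial_limit_at_right_real] by blast
  then show thesis by (intro that[of d]) auto
qed

text \<open>Periods are expressed as solutions of exp s = 1 and nesting by insides, the form in
  which the lemmas on translated curves take them. Dropping contour 0 preserves the conditions, as
  the induction requires.\<close>

definition admissible_contours ::
  "complex set \<Rightarrow> nat \<Rightarrow> (nat \<Rightarrow> complex) \<Rightarrow> (nat \<Rightarrow> real \<Rightarrow> complex) \<Rightarrow> bool" where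
  "admissible_contours \<Omega> k c \<gamma> \<longleftrightarrow>
     (\<forall>i<k. exp (c i) \<noteq> 1 \<and> pos_contour_around0 \<Omega> (\<gamma> i) \<and> pos_contour_around0 \<Omega> (\<lambda>t. \<gamma> i t + c i)) \<and>
     (\<forall>i j. i < j \<longrightarrow> j < k \<longrightarrow> path_image (\<lambda>t. \<gamma> i t + c i) \<subseteq> inside (path_image (\<gamma> j)) \<and>
       (\<forall>u\<in>path_image (\<gamma> i).
          (\<forall>s. exp s = 1 \<longrightarrow> s \<noteq> 0 \<longrightarrow> winding_number (\<gamma> j) (u + c i + s) = 0) \<and>
          (\<forall>v\<in>path_image (\<gamma> j). exp v \<noteq> exp (u + c i) \<and> exp (v + c j) \<noteq> exp u)))"

lemma admissible_contoursD:
  assumes "admissible_contours \<Omega> k c \<gamma>"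
  shows "\<And>i. i < k \<Longrightarrow> exp (c i) \<noteq> 1" "\<And>i. i < k \<Longrightarrow> path (\<gamma> i)"
    "\<And>i. i < k \<Longrightarrow> simple_path (\<gamma> i)" "\<And>i. i < k \<Longrightarrow> pathfinish (\<gamma> i) = pathstart (\<gamma> i)"
    "\<And>i. i < k \<Longrightarrow> path_image (\<gamma> i) \<subseteq> \<Omega>"
    "\<And>i u. i < k \<Longrightarrow> u \<in> path_image (\<gamma> i) \<Longrightarrow> u + c i \<in> \<Omega>"
    "\<And>i j. i < j \<Longrightarrow> j < k \<Longrightarrow> path_image (\<lambda>t. \<gamma> i t + c i) \<subseteq> inside (path_image (\<gamma> j))"
    "\<And>i j u s. i < j \<Longrightarrow> j < k \<Longrightarrow> u \<in> path_image (\<gamma> i) \<Longrightarrow> exp s = 1 \<Longrightarrow> s \<noteq> 0 \<Longrightarrow>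
       winding_number (\<gamma> j) (u + c i + s) = 0"
    "\<And>i j u v. i < j \<Longrightarrow> j < k \<Longrightarrow> u \<in> path_image (\<gamma> i) \<Longrightarrow> v \<in> path_image (\<gamma> j) \<Longrightarrow>
       exp v \<noteq> exp (u + c i) \<and> exp (v + c j) \<noteq> exp u"
    "\<And>i. i < k \<Longrightarrow> valid_path (\<gamma> i)"
  using assms by (auto simp: admissible_contours_def pos_contour_around0_def valid_path_imp_path
      path_image_translate subset_iff)

lemma admissible_contours_Suc:
  assumes "admissible_contours \<Omega> (Suc k) c \<gamma>"
  shows "admissible_contours \<Omega> k (\<lambda>i. c (Suc i)) (\<lambda>i. \<gamma> (Suc i))"
proof -
  note a = assms[unfolded admissible_contours_def, THEN conjunct1]
    and b = assms[unfolded admissible_contours_def, THEN conjunct2]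
  show ?thesis
    unfolding admissible_contours_def
    by (rule conjI, intro allI impI, rule a[THEN spec, THEN mp], simp, intro allI impI,
        rule b[THEN spec, THEN spec, THEN mp, THEN mp]) simp_all
qed

lemma admissible_contours_inside:
  assumes "admissible_contours \<Omega> k c \<gamma>" "i < k"
  shows "inside (path_image (\<gamma> i)) \<subseteq> \<Omega>"
    and "\<And>z. z \<in> inside (path_image (\<gamma> i)) \<Longrightarrow> z + c i \<in> \<Omega>"
    and "\<And>z. z \<in> inside (path_image (\<gamma> i)) \<Longrightarrow> winding_number (\<gamma> i) z = 1"
proof -
  have g: "pos_contour_around0 \<Omega> (\<gamma> i)" "pos_contour_around0 \<Omega> (\<lambda>t. \<gamma> i t + c i)"
    using assms by (auto simp: admissible_contours_def)
  have sub: "inside (path_image g) \<subseteq> \<Omega>" if "pos_contour_around0 \<Omega> g" for g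
    using that by (auto simp: pos_contour_around0_def inside_simple_closed_path_iff)
  show "inside (path_image (\<gamma> i)) \<subseteq> \<Omega>" by (rule sub[OF g(1)])
  fix z assume z: "z \<in> inside (path_image (\<gamma> i))"
  show "z + c i \<in> \<Omega>"
    using sub[OF g(2)] z admissible_contoursD(3,4)[OF assms]
    by (auto simp: inside_path_image_translate)
  have "0 \<in> inside (path_image (\<gamma> i))"
    using g(1) by (auto simp: pos_contour_around0_def inside_simple_closed_path_iff)
  then have "winding_number (\<gamma> i) z = winding_number (\<gamma> i) 0"
    by (intro winding_number_inside_eq admissible_contoursD(3,4)[OF assms(1)] assms(2) z)
  then show "winding_number (\<gamma> i) z = 1"
    using g(1) by (simp add: pos_contour_around0_def)
qed

text \<open>The point z is stored in coordinates k, ..., k + N - 1 instead of being fixed: joint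
  continuity near \<open>z0\<close> will give continuity of the iterated integral in z.\<close>

lemma lift_integrand_separately_holomorphic:
  assumes lift: "supersymmetric_lift \<Omega> N S St" and "open \<Omega>" and z0: "z0 \<in> points \<Omega> N"
    and adm: "admissible_contours \<Omega> k c \<gamma>"
    and pole: "\<forall>i<k. \<forall>u\<in>path_image (\<gamma> i). \<forall>m<N. exp u \<noteq> exp (z0 ! m)"
  shows "\<exists>U. (\<forall>i<k. open (U i) \<and> path_image (\<gamma> i) \<subseteq> U i) \<and>
    (\<forall>m<N. open (U (k + m)) \<and> z0 ! m \<in> U (k + m)) \<and> (\<forall>i\<ge>k + N. U i = UNIV) \<and>
    separately_holomorphic U k (\<lambda>u. lift_integrand St k c (map (\<lambda>m. u (k + m)) [0..<N]) u)"
proof -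
  let ?n = "k + N"
  note cnz = admissible_contoursD(1)[OF adm] and \<gamma> = admissible_contoursD(2,5,6)[OF adm]
    and avoid = admissible_contoursD(9)[OF adm]
  define K where "K = (\<lambda>i. if i < k then path_image (\<gamma> i) else {z0 ! (i - k)})"
  \<comment> \<open>\<open>R i j\<close> says that no denominator involving coordinates i and j
    vanishes: those of the cross factors for two integration variables, those of the pole factors
    for an integration variable and an entry of z.\<close>
  define R where "R = (\<lambda>i j. if i < j \<and> j < k then
      {p. exp (snd p) \<noteq> exp (fst p + c i) \<and> exp (snd p + c j) \<noteq> exp (fst p)}
    else if i < k \<and> k \<le> j then {p::complex \<times> complex. exp (fst p) \<noteq> exp (snd p)} else UNIV)"
  have "compact (K i)" for i by (auto simp: K_def \<gamma> compact_path_image)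
  moreover have "open (R i j)" for i j
    unfolding R_def
    by (auto intro!: open_Collect_conj open_Collect_neq continuous_intros)
  moreover have "K i \<times> K j \<subseteq> R i j" if "i < ?n" "j < ?n" for i j
    using that avoid pole by (auto simp: K_def R_def)
  ultimately obtain d where d: "d > 0" "\<And>i j x y. i < ?n \<Longrightarrow> j < ?n \<Longrightarrow>
      x \<in> (\<Union>a\<in>K i. ball a d) \<Longrightarrow> y \<in> (\<Union>a\<in>K j. ball a d) \<Longrightarrow> (x, y) \<in> R i j"
    using compact_pairwise_neighbourhoods[of ?n K R] by blast
  define B where "B = (\<lambda>i. \<Union>a\<in>K i. ball a d)"
  have dB: "(x, y) \<in> R i j" if "i < ?n" "j < ?n" "x \<in> B i" "y \<in> B j" for i j x y
    using d(2) that unfolding B_def by blast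
  define U where "U = (\<lambda>i. if i < k then B i \<inter> \<Omega> \<inter> (\<lambda>t. t + c i) -` \<Omega> else if i < ?n then B i \<inter> \<Omega> else UNIV)"
  have KB: "K i \<subseteq> B i" for i using d(1) by (force simp: B_def)
  have UB: "U i \<subseteq> B i" if "i < ?n" for i using that by (auto simp: U_def)
  have opU: "open (U i)" for i
  proof -
    have "open ((\<lambda>t. t + c i) -` \<Omega>)"
      using \<open>open \<Omega>\<close> by (intro open_vimage) (auto intro: continuous_intros)
    moreover have "open (B i)" by (auto simp: B_def)
    ultimately show ?thesis using \<open>open \<Omega>\<close> by (auto simp: U_def)
  qed
  have Upath: "path_image (\<gamma> i) \<subseteq> U i" if "i < k" for i
    using that KB[of i] \<gamma> by (auto simp: U_def K_def)
  have Uz: "z0 ! m \<in> U (k + m)" if "m < N" for m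
    using that KB[of "k + m"] z0 by (auto simp: U_def K_def points_def)
  have O1: "exp (u j) \<noteq> exp (u i + c i) \<and> exp (u j + c j) \<noteq> exp (u i)"
    if "u \<in> Pi UNIV U" "i < j" "j < k" for u i j
  proof -
    have "(u i, u j) \<in> R i j"
      using that UB[of i] UB[of j] by (intro dB) auto
    then show ?thesis using that by (simp add: R_def)
  qed
  have O2: "exp (u i) \<noteq> exp (u (k + m))" if "u \<in> Pi UNIV U" "i < k" "m < N" for u i m
  proof -
    have "(u i, u (k + m)) \<in> R i (k + m)"
      using that UB[of i] UB[of "k + m"] by (intro dB) auto
    then show ?thesis using that by (simp add: R_def)
  qed
  have U\<Omega>: "u i \<in> \<Omega>" if "u \<in> Pi UNIV U" "i < ?n" for u i
  proof -
    have "u i \<in> U i" using that by auto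
    then show ?thesis using that by (auto simp: U_def split: if_splits)
  qed
  have U\<Omega>': "u i + c i \<in> \<Omega>" if "u \<in> Pi UNIV U" "i < k" for u i
  proof -
    have "u i \<in> U i" using that by auto
    then show ?thesis using that by (auto simp: U_def split: if_splits)
  qed
  let ?z = "\<lambda>u. map (\<lambda>m. u (k + m)) [0..<N] :: complex list"
  have cu: "continuous_on (Pi UNIV U) (\<lambda>u. u i)" for i
    by (rule continuous_on_subset[OF continuous_on_product_coordinates]) auto
  have an: "analytic_lists \<Omega> (N + k + k) (\<lambda>v. St k (take (N + k) v) (drop (N + k) v))"
    using lift by (simp add: supersymmetric_lift_def)
  have "continuous_on (Pi UNIV U) (\<lambda>u. (\<lambda>v. St k (take (N + k) v) (drop (N + k) v))
     (map (\<lambda>i. u i + c i) [0..<k] @ ?z u @ map u [0..<k]))"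
  proof (rule analytic_lists_continuous[OF an])
    show "map (\<lambda>i. u i + c i) [0..<k] @ ?z u @ map u [0..<k] \<in> points \<Omega> (N + k + k)"
      if "u \<in> Pi UNIV U" for u
      using U\<Omega>[OF that] U\<Omega>'[OF that] by (auto simp: points_def)
    show "continuous_on (Pi UNIV U) (\<lambda>u. (map (\<lambda>i. u i + c i) [0..<k] @ ?z u @ map u [0..<k]) ! i)"
      if "i < N + k + k" for i
    proof -
      consider "i < k" | "k \<le> i" "i < k + N" | "k + N \<le> i" by linarith
      then show ?thesis
      proof cases
        case 1
        then show ?thesis using cu by (simp add: nth_append continuous_on_add continuous_on_const)
      next
        case 2
        then have "i - k < N" "\<not> i < k" by auto
        then show ?thesis using cu by (simp add: nth_append)
      next
        case 3
        then have "i - k - N < k" "\<not> i < k" "\<not> i - k < N" using that by auto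
        then show ?thesis using cu by (simp add: nth_append)
      qed
    qed
  qed
  then have cSt: "continuous_on (Pi UNIV U) (\<lambda>u. St k (map (\<lambda>i. u i + c i) [0..<k] @ ?z u) (map u [0..<k]))"
    by simp
  have cpf: "continuous_on (Pi UNIV U) (\<lambda>u. pole_factor (u i) (c i) (?z u ! m))" if "i < k" "m < N" for i m
    unfolding pole_factor_def using O2[OF _ that] that
    by (auto intro!: continuous_on_divide continuous_on_diff continuous_on_exp continuous_on_add
        continuous_on_const cu)
  have ccf: "continuous_on (Pi UNIV U) (\<lambda>u. cross_factor (u i) (c i) (u j) (c j))" if "i < j" "j < k" for i j
    unfolding cross_factor_def using O1[OF _ that]
    by (intro continuous_on_divide continuous_on_mult continuous_on_diff continuous_on_exp continuous_on_add
        continuous_on_const cu) auto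
  have "continuous_on (Pi UNIV U) (\<lambda>u. lift_integrand St k c (?z u) u)"
    unfolding lift_integrand_def length_map length_upt diff_zero using cnz
    by (intro continuous_on_mult continuous_on_prod continuous_on_divide continuous_on_const cSt cpf ccf) auto
  moreover have "(\<lambda>t. lift_integrand St k c (?z (u(i := t))) (u(i := t))) holomorphic_on U i"
    if u: "u \<in> Pi UNIV U" and i: "i < k" for u i
  proof -
    have eq: "?z (u(i := t)) = ?z u" for t using i by simp
    have upd: "u(i := t) \<in> Pi UNIV U" if "t \<in> U i" for t using u that by (auto simp: Pi_def)
    show ?thesis unfolding eq
    proof (rule lift_integrand_holomorphic[OF lift _ i])
      show "?z u \<in> points \<Omega> N" using U\<Omega>[OF u] by (auto simp: points_def)
      show "exp ((u(i := t)) a) \<noteq> exp (?z u ! m)" if "t \<in> U i" "a < k" "m < N" for t a m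
        using O2[OF upd[OF that(1)] that(2,3)] that i by auto
      show "u j \<in> \<Omega> \<and> u j + c j \<in> \<Omega>" if "j < k" for j
        using U\<Omega>[OF u] U\<Omega>'[OF u] that by simp
      show "U i \<subseteq> \<Omega>" "(\<lambda>t. t + c i) ` U i \<subseteq> \<Omega>" using i by (auto simp: U_def)
      show "exp ((u(i := t)) b) \<noteq> exp ((u(i := t)) a + c a) \<and> exp ((u(i := t)) b + c b) \<noteq> exp ((u(i := t)) a)"
        if "t \<in> U i" "a < b" "b < k" for t a b
        by (rule O1[OF upd[OF that(1)] that(2,3)])
    qed (simp_all add: opU cnz)
  qed
  ultimately have "separately_holomorphic U k (\<lambda>u. lift_integrand St k c (?z u) u)"
    unfolding separately_holomorphic_def by blast
  moreover have "U i = UNIV" if "k + N \<le> i" for i using that by (simp add: U_def)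
  ultimately show ?thesis
    using opU Upath Uz by (intro exI[of _ U]) simp
qed

text \<open>Freezing z leaves the coordinates from \<open>k\<close> on unconstrained, so that
  domains for different z can be intersected and the starting point of the iteration is free
  there.\<close>

lemma lift_integrand_separately_holomorphic_fixed:
  assumes "supersymmetric_lift \<Omega> N S St" "open \<Omega>" "z \<in> points \<Omega> N"
    and "admissible_contours \<Omega> k c \<gamma>"
    and "\<forall>i<k. \<forall>u\<in>path_image (\<gamma> i). \<forall>m<N. exp u \<noteq> exp (z ! m)"
  shows "\<exists>U. (\<forall>i<k. open (U i) \<and> path_image (\<gamma> i) \<subseteq> U i) \<and> (\<forall>i\<ge>k. U i = UNIV) \<and>
    separately_holomorphic U k (lift_integrand St k c z)"
proof -
  let ?F = "\<lambda>u. lift_integrand St k c (map (\<lambda>m. u (k + m)) [0..<N]) u"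
  obtain U where U: "\<forall>i<k. open (U i) \<and> path_image (\<gamma> i) \<subseteq> U i"
    "\<forall>m<N. open (U (k + m)) \<and> z ! m \<in> U (k + m)" "\<forall>i\<ge>k + N. U i = UNIV" "separately_holomorphic U k ?F"
    using lift_integrand_separately_holomorphic[OF assms] by (elim exE conjE)
  define U' where "U' = (\<lambda>i. if i < k then U i else UNIV)"
  define \<iota> where "\<iota> = (\<lambda>u i. if i < k then u i else z ! (i - k) :: complex)"
  have \<iota>: "\<iota> u \<in> Pi UNIV U" if "u \<in> Pi UNIV U'" for u
  proof (intro Pi_I)
    fix i
    consider "i < k" | "k \<le> i" "i - k < N" | "k + N \<le> i" by linarith
    then show "\<iota> u i \<in> U i"
    proof cases
      case 1
      have "u i \<in> U' i" using that by auto
      then show ?thesis using 1 by (simp add: \<iota>_def U'_def)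
    next
      case 2
      then show ?thesis using U(2)[rule_format, of "i - k"] by (simp add: \<iota>_def)
    qed (simp add: U(3))
  qed
  have lz: "length z = N" using assms(3) by (simp add: points_def)
  then have z: "map (\<lambda>m. \<iota> u (k + m)) [0..<N] = z" for u
    by (intro nth_equalityI) (auto simp: \<iota>_def)
  have eq: "?F (\<iota> u) = lift_integrand St k c z u" for u
    unfolding z by (auto simp: lift_integrand_def \<iota>_def cong: map_cong intro!: prod.cong
      arg_cong2[of _ _ _ _ "(*)"] arg_cong2[of _ _ _ _ "St k"])
  have cont: "continuous_on (Pi UNIV U) ?F"
    and hol: "\<And>u i. u \<in> Pi UNIV U \<Longrightarrow> i < k \<Longrightarrow> (\<lambda>t. ?F (u(i := t))) holomorphic_on U i"
    using U(4) by (simp_all add: separately_holomorphic_def)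
  have "continuous_on (Pi UNIV U') \<iota>"
  proof (rule continuous_on_coordinatewise_then_product)
    have "continuous_on (Pi UNIV U') (\<lambda>u. u i)" for i
      by (rule continuous_on_subset[OF continuous_on_product_coordinates]) auto
    then show "continuous_on (Pi UNIV U') (\<lambda>u. \<iota> u i)" for i
      by (cases "i < k") (simp_all add: \<iota>_def)
  qed
  then have "continuous_on (Pi UNIV U') (\<lambda>u. ?F (\<iota> u))"
    by (rule continuous_on_compose2[OF cont]) (use \<iota> in blast)
  moreover have "(\<lambda>t. ?F (\<iota> (u(i := t)))) holomorphic_on U' i" if "u \<in> Pi UNIV U'" "i < k" for u i
  proof -
    have "\<iota> (u(i := t)) = (\<iota> u)(i := t)" for t using that by (auto simp: \<iota>_def)
    then show ?thesis using hol[OF \<iota>[OF that(1)] that(2)] that(2) by (simp add: U'_def)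
  qed
  ultimately have "separately_holomorphic U' k (lift_integrand St k c z)"
    unfolding eq separately_holomorphic_def by blast
  then show ?thesis using U by (intro exI[of _ U']) (auto simp: U'_def)
qed

section \<open>Evaluation by residues\<close>

text \<open>The lift cancels only the last entries of its two lists; by symmetry z_j is moved there.
  In the first list the translated value \<open>a\<close> then takes the place that z_j has left in
  \<open>z\<close>.\<close>

lemma supersymmetric_lift_cancel:
  assumes lift: "supersymmetric_lift \<Omega> N S St" and xs: "xs \<in> points \<Omega> k" and ys: "ys \<in> points \<Omega> k"
    and z: "z \<in> points \<Omega> N" and j: "j < N" and a: "a \<in> \<Omega>"
  shows "St (Suc k) (a # xs @ z) (z ! j # ys) = St k (xs @ z[j := a]) ys"
proof -
  have lz: "length z = N" and zj: "z ! j \<in> \<Omega>" using z j by (auto simp: points_def)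
  have pz: "z[j := a] \<in> points \<Omega> N" by (rule points_list_update[OF z a])
  have "mset (z[j := a]) = add_mset a (mset z - {#z ! j#})" using j lz by (simp add: mset_update)
  then have "mset (a # xs @ z) = mset ((xs @ z[j := a]) @ [z ! j])"
    using nth_mem_mset[of j z] j lz by (simp add: add_mset_commute)
  moreover have px: "(xs @ z[j := a]) @ [z ! j] \<in> points \<Omega> (N + Suc k)"
    using xs pz zj by (auto simp: points_def)
  moreover have py: "ys @ [z ! j] \<in> points \<Omega> (Suc k)" using ys zj by (auto simp: points_def)
  moreover have "mset (z ! j # ys) = mset (ys @ [z ! j])" by simp
  moreover have py': "z ! j # ys \<in> points \<Omega> (Suc k)" using ys zj by (auto simp: points_def)
  moreover have s1: "\<And>k x x' y. x \<in> points \<Omega> (N + k) \<Longrightarrow> y \<in> points \<Omega> k \<Longrightarrow> mset x' = mset x \<Longrightarrow> St k x' y = St k x y"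
    and s2: "\<And>k x y y'. x \<in> points \<Omega> (N + k) \<Longrightarrow> y \<in> points \<Omega> k \<Longrightarrow> mset y' = mset y \<Longrightarrow> St k x y' = St k x y"
    and s3: "\<And>k x y. x \<in> points \<Omega> (N + Suc k) \<Longrightarrow> y \<in> points \<Omega> (Suc k) \<Longrightarrow> last x = last y \<Longrightarrow>
        St (Suc k) x y = St k (butlast x) (butlast y)"
    using lift unfolding supersymmetric_lift_def by blast+
  ultimately have "St (Suc k) (a # xs @ z) (z ! j # ys) = St (Suc k) ((xs @ z[j := a]) @ [z ! j]) (ys @ [z ! j])"
    by (metis s1 s2)
  also have "\<dots> = St k (xs @ z[j := a]) ys"
    using s3[OF px py] by (simp add: butlast_append)
  finally show ?thesis .
qed

text \<open>The plane without the nonzero 2 pi i translates of z, with z itself kept. Openness at z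
  holds because exp is injective on the ball of radius pi around z.\<close>

lemma open_exp_eq_imp_eq: "open {t. exp t = exp z \<longrightarrow> t = (z::complex)}"
proof (subst open_subopen, intro ballI)
  fix t :: complex assume t: "t \<in> {t. exp t = exp z \<longrightarrow> t = z}"
  show "\<exists>T. open T \<and> t \<in> T \<and> T \<subseteq> {t. exp t = exp z \<longrightarrow> t = z}"
  proof (cases "exp t = exp z")
    case True
    then have "t = z" using t by simp
    moreover have "exp s = exp z \<longrightarrow> s = z" if "s \<in> ball z 1" for s
    proof
      assume "exp s = exp z"
      moreover have "s \<in> ball z pi" using that pi_gt3 by simp
      ultimately show "s = z" using inj_onD[OF inj_on_exp_pi[of z]] by simp
    qed
    ultimately show ?thesis by (intro exI[of _ "ball z 1"]) auto
  next
    case False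
    have "open {t. exp t \<noteq> exp z}" by (intro open_Collect_neq continuous_intros)
    then show ?thesis using False by (intro exI[of _ "{t. exp t \<noteq> exp z}"]) auto
  qed
qed

lemma exp_diff_quotient_limit:
  "((\<lambda>t. (t - z) / (exp t - exp z)) \<longlongrightarrow> 1 / exp z) (at z)" for z :: complex
proof -
  have "(exp has_field_derivative exp z) (at z)" by (rule DERIV_exp)
  then have "((\<lambda>t. (exp t - exp z) / (t - z)) \<longlongrightarrow> exp z) (at z)"
    by (simp add: has_field_derivative_iff)
  then have "((\<lambda>t. 1 / ((exp t - exp z) / (t - z))) \<longlongrightarrow> 1 / exp z) (at z)"
    by (intro tendsto_intros) auto
  then show ?thesis by simp
qed

text \<open>Each contour then picks up exactly one of the poles in the lattice of \<open>x\<close>: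
  it encloses \<open>x\<close>, and neither meets nor encloses the other 2 pi i translates.\<close>

definition admissible_point :: "nat \<Rightarrow> (nat \<Rightarrow> real \<Rightarrow> complex) \<Rightarrow> complex \<Rightarrow> bool" where
  "admissible_point k \<gamma> x \<longleftrightarrow> (\<forall>i<k. x \<in> inside (path_image (\<gamma> i)) \<and>
     (\<forall>t. exp t = exp x \<longrightarrow> t \<notin> path_image (\<gamma> i) \<and> (t \<noteq> x \<longrightarrow> winding_number (\<gamma> i) t = 0)))"

lemma admissible_point_Suc:
  "admissible_point (Suc k) \<gamma> x \<Longrightarrow> admissible_point k (\<lambda>i. \<gamma> (Suc i)) x"
  by (simp add: admissible_point_def)

text \<open>The translated contour 0, hence everything it encloses, lies inside each later contour;
  for the periods, \<open>winding_number_zero_period_shift\<close> passes from the curve to its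
  inside.\<close>

lemma admissible_point_shift:
  assumes adm: "admissible_contours \<Omega> (Suc k) c \<gamma>" and x: "admissible_point (Suc k) \<gamma> x"
  shows "admissible_point k (\<lambda>i. \<gamma> (Suc i)) (x + c 0)"
  unfolding admissible_point_def
proof (intro allI impI conjI)
  fix i assume i: "i < k"
  note D = admissible_contoursD[OF adm]
  have xin: "x \<in> inside (path_image (\<gamma> 0))" using x by (simp add: admissible_point_def)
  have nest: "path_image (\<lambda>t. \<gamma> 0 t + c 0) \<subseteq> inside (path_image (\<gamma> (Suc i)))"
    using D(7)[of 0 "Suc i"] i by simp
  have sp: "simple_path (\<lambda>t. \<gamma> 0 t + c 0)" by (rule simple_path_translate[OF D(3)]) simp
  have "inside (path_image (\<lambda>t. \<gamma> 0 t + c 0)) \<subseteq> inside (path_image (\<gamma> (Suc i)))"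
    using nest sp D(3)[of "Suc i"] i
    by (intro inside_inside_compact_connected)
       (auto intro: compact_imp_closed compact_simple_path_image connected_simple_path_image)
  moreover have "x + c 0 \<in> inside (path_image (\<lambda>t. \<gamma> 0 t + c 0))"
    using xin D(3,4)[of 0] by (simp add: inside_path_image_translate)
  ultimately show x0: "x + c 0 \<in> inside (path_image (\<gamma> (Suc i)))" by blast
  fix t assume t: "exp t = exp (x + c 0)"
  define s where "s = t - (x + c 0)"
  have s: "exp s = 1" "t = x + c 0 + s" using t by (auto simp: s_def exp_diff)
  have shift: "t \<notin> path_image (\<gamma> (Suc i)) \<and> winding_number (\<gamma> (Suc i)) t = 0" if "t \<noteq> x + c 0"
    unfolding s(2)
  proof (rule winding_number_zero_period_shift[OF D(3,4) D(2,4) nest _ s(1) _ xin])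
    show "exp v \<noteq> exp (y + c 0)" if "y \<in> path_image (\<gamma> 0)" "v \<in> path_image (\<gamma> (Suc i))" for y v
      using D(9)[of 0 "Suc i"] i that by simp
    show "winding_number (\<gamma> (Suc i)) (y + c 0 + s) = 0" if "y \<in> path_image (\<gamma> 0)" for y
      using D(8)[of 0 "Suc i" y s] i that s \<open>t \<noteq> x + c 0\<close> by auto
  qed (use i in auto)
  then show "t \<notin> path_image (\<gamma> (Suc i))"
    using x0 by (metis disjoint_iff inside_no_overlap)
  show "winding_number (\<gamma> (Suc i)) t = 0" if "t \<noteq> x + c 0" using shift that by simp
qed

text \<open>At the pole t = z ! j the cross factors turn the factors of z ! j into those of z ! j + c 0.\<close>

lemma residue_step:
  assumes lift: "supersymmetric_lift \<Omega> N S St" and "open \<Omega>"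
    and adm: "admissible_contours \<Omega> (Suc k) c \<gamma>"
    and z: "z \<in> points \<Omega> N" "exp_distinct z" and adz: "\<And>x. x \<in> set z \<Longrightarrow> admissible_point (Suc k) \<gamma> x"
    and v: "\<And>j. j < k \<Longrightarrow> v j \<in> path_image (\<gamma> (Suc j))"
  shows "contour_integral (\<gamma> 0) (\<lambda>t. lift_integrand St (Suc k) c z (case_nat t v)) =
    2 * of_real pi * \<i> * (\<Sum>j<N. shift_coeff (c 0) z j *
       lift_integrand St k (\<lambda>i. c (Suc i)) (z[j := z ! j + c 0]) v)"
proof -
  note D = admissible_contoursD[OF adm] and I = admissible_contours_inside[OF adm]
  let ?g = "\<gamma> 0"
  define W where "W = {t\<in>\<Omega>. t + c 0 \<in> \<Omega>}"
  \<comment> \<open>\<open>W\<close> without the zeros of denominators in t, except for the points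
    z_m themselves.\<close>
  define S1 where "S1 = W \<inter> (\<Inter>m\<in>{..<N}. {t. exp t = exp (z ! m) \<longrightarrow> t = z ! m}) \<inter>
     (\<Inter>j\<in>{..<k}. {t. exp (v j) \<noteq> exp (t + c 0) \<and> exp (v j + c (Suc j)) \<noteq> exp t})"
  have lz: "length z = N" using z by (simp add: points_def)
  have adz': "admissible_point (Suc k) \<gamma> (z ! m)" if "m < N" for m using adz that lz by simp
  have zin: "z ! m \<in> inside (path_image ?g)" if "m < N" for m
    using adz'[OF that] by (simp add: admissible_point_def)
  have zpole: "exp u \<noteq> exp (z ! m)" if "i < Suc k" "u \<in> path_image (\<gamma> i)" "m < N" for i u m
    using adz'[OF that(3)] that(1,2) unfolding admissible_point_def by blast
  have zne: "exp (z ! m) \<noteq> exp (z ! m')" if "m < N" "m' < N" "m \<noteq> m'" for m m'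
    using z(2) that lz by (simp add: exp_distinct_iff)
  have vO: "v j \<in> \<Omega>" "v j + c (Suc j) \<in> \<Omega>" if "j < k" for j
    using D(5,6)[of "Suc j"] v[OF that] that by auto
  have vv: "exp (v j) \<noteq> exp (v i + c (Suc i)) \<and> exp (v j + c (Suc j)) \<noteq> exp (v i)" if "i < j" "j < k" for i j
    using D(9)[of "Suc i" "Suc j"] v that by simp
  have vz: "exp (v j) \<noteq> exp (z ! m)" if "j < k" "m < N" for j m
    using zpole[of "Suc j"] v that by simp
  have wn1: "winding_number ?g t = 0" if "exp (t + c 0) = exp (v j)" "j < k" for t j
  proof (rule winding_number_zero_preimage_shift[OF D(3,4) D(2) D(7) _ v[OF that(2)] that(1)])
    show "exp v \<noteq> exp (x + c 0)" if "x \<in> path_image ?g" "v \<in> path_image (\<gamma> (Suc j))" for x v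
      using D(9)[of 0 "Suc j"] that \<open>j < k\<close> by simp
  qed (use that in auto)
  have wn2: "winding_number ?g t = 0" if "exp t = exp (v j + c (Suc j))" "j < k" for t j
  proof (rule winding_number_zero_image_shift[OF D(3,4) D(3,4) D(7) _ v[OF that(2)] that(1)])
    show "exp (v + c (Suc j)) \<noteq> exp x" if "x \<in> path_image ?g" "v \<in> path_image (\<gamma> (Suc j))" for x v
      using D(9)[of 0 "Suc j"] that \<open>j < k\<close> by simp
  qed (use that in auto)
  have gin: "w \<in> inside (path_image ?g)" if "w \<notin> path_image ?g" "winding_number ?g w \<noteq> 0" for w
    using that D(3,4)[of 0] by (simp add: inside_simple_closed_path_iff)
  have pS1: "path_image ?g \<subseteq> S1"
  proof
    fix t assume t: "t \<in> path_image ?g"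
    have "t \<in> W" using D(5,6)[of 0] t by (auto simp: W_def)
    moreover have "exp t \<noteq> exp (z ! m)" if "m < N" for m using zpole[of 0 t m] t that by simp
    moreover have "exp (v j) \<noteq> exp (t + c 0) \<and> exp (v j + c (Suc j)) \<noteq> exp t" if "j < k" for j
      using D(9)[of 0 "Suc j" t "v j"] v that t by simp
    ultimately show "t \<in> S1" by (auto simp: S1_def)
  qed
  \<comment> \<open>All points outside \<open>S1\<close> have winding number 0, so only residues at
    the z_m remain. Here nesting and admissibility of the entries of z enter.\<close>
  have wnS1: "winding_number ?g w = 0" if "w \<notin> S1" for w
  proof (rule ccontr)
    assume wn: "winding_number ?g w \<noteq> 0"
    then have w: "w \<in> inside (path_image ?g)" using gin pS1 that by blast
    have "w \<in> W" using I(1,2)[of 0] w by (auto simp: W_def)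
    moreover have "w = z ! m" if "m < N" "exp w = exp (z ! m)" for m
      using adz'[OF that(1)] that(2) wn unfolding admissible_point_def by blast
    moreover have "exp (v j) \<noteq> exp (w + c 0) \<and> exp (v j + c (Suc j)) \<noteq> exp w" if "j < k" for j
      using wn1[of w j] wn2[of w j] that wn by auto
    ultimately have "w \<in> S1" by (auto simp: S1_def)
    then show False using that by simp
  qed
  have zS1: "z ! m \<in> S1" if "m < N" for m
    using wnS1[of "z ! m"] I(3)[of 0, OF _ zin[OF that]] by auto
  have opW: "open W"
  proof -
    have "W = \<Omega> \<inter> (\<lambda>t. t + c 0) -` \<Omega>" by (auto simp: W_def)
    moreover have "open ((\<lambda>t. t + c 0) -` \<Omega>)"
      using \<open>open \<Omega>\<close> by (intro open_vimage) (auto intro: continuous_intros)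
    ultimately show ?thesis using \<open>open \<Omega>\<close> by auto
  qed
  have opS1: "open S1"
    unfolding S1_def
    by (intro open_Int opW open_INT finite_lessThan ballI open_exp_eq_imp_eq open_Collect_conj
        open_Collect_neq continuous_intros)
  \<comment> \<open>Index 0 gets a dummy value, since the integrand is always evaluated after
    updating it to t.\<close>
  define v0 where "v0 = (\<lambda>j. case_nat 0 v j)"
  have v0: "v0 (Suc j) = v j" for j by (simp add: v0_def)
  have upd: "case_nat t v = v0(0 := t)" for t by (auto simp: v0_def split: nat.split)
  have hol: "(\<lambda>t. lift_integrand St (Suc k) c z (case_nat t v)) holomorphic_on S1 - set z"
    unfolding upd
  proof (rule lift_integrand_holomorphic[OF lift z(1)])
    show "open (S1 - set z)" using opS1 by (simp add: finite_imp_closed open_Diff)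
    show "exp (c j) \<noteq> 1" if "j < Suc k" for j using D(1) that .
    show "v0 j \<in> \<Omega> \<and> v0 j + c j \<in> \<Omega>" if "j < Suc k" "j \<noteq> 0" for j
      using that vO by (cases j) (auto simp: v0)
    show "exp ((v0(0 := t)) b) \<noteq> exp ((v0(0 := t)) a + c a) \<and>
        exp ((v0(0 := t)) b + c b) \<noteq> exp ((v0(0 := t)) a)"
      if "t \<in> S1 - set z" "a < b" "b < Suc k" for t a b
      using that vv by (cases a; cases b) (auto simp: S1_def v0)
    show "exp ((v0(0 := t)) a) \<noteq> exp (z ! m)"
      if "t \<in> S1 - set z" "a < Suc k" "m < N" for t a m
      using that vz lz by (cases a) (auto simp: S1_def v0)
  qed (auto simp: S1_def W_def)
  have lim: "((\<lambda>t. (t - z ! j) * lift_integrand St (Suc k) c z (case_nat t v)) \<longlongrightarrow>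
      shift_coeff (c 0) z j * lift_integrand St k (\<lambda>i. c (Suc i)) (z[j := z ! j + c 0]) v) (at (z ! j))"
    if j: "j < N" for j
  proof -
    let ?zj = "z ! j" and ?z' = "z[j := z ! j + c 0]"
    let ?xs = "map (\<lambda>i. v i + c (Suc i)) [0..<k]" and ?ys = "map v [0..<k]"
    let ?St = "\<lambda>t. St (Suc k) ((t + c 0) # ?xs @ z) (t # ?ys)"
    let ?C = "\<Prod>i<k. \<Prod>j\<in>{i<..<k}. cross_factor (v i) (c (Suc i)) (v j) (c (Suc j))"
    let ?P = "\<Prod>i<k. (\<Prod>m<N. pole_factor (v i) (c (Suc i)) (z ! m)) / (exp (c (Suc i)) - 1)"
    \<comment> \<open>The integrand without the factor 1 / (exp t - exp z_j); it has a limit at z_j,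
      obtained by substitution.\<close>
    let ?R = "\<lambda>t. ?St t * (\<Prod>i<k. cross_factor t (c 0) (v i) (c (Suc i))) * ?C *
       ((\<Prod>m\<in>{..<N} - {j}. pole_factor t (c 0) (z ! m)) * (exp (t + c 0) - exp ?zj) / (exp (c 0) - 1) * ?P)"
    have zjS: "?zj \<in> S1" "?zj \<in> W" using zS1[OF j] by (auto simp: S1_def)
    have e0: "exp (c 0) - 1 \<noteq> 0" using D(1)[of 0] by simp
    have "(\<lambda>t. St (Suc k) (map (\<lambda>j. (v0(0 := t)) j + c j) [0..<Suc k] @ z)
        (map (v0(0 := t)) [0..<Suc k])) holomorphic_on W"
    proof (rule supersymmetric_lift_holomorphic[OF lift z(1) _ _ opW])
      show "v0 j \<in> \<Omega> \<and> v0 j + c j \<in> \<Omega>" if "j < Suc k" "j \<noteq> 0" for j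
        using that vO by (cases j) (auto simp: v0)
    qed (auto simp: W_def)
    moreover have "[0..<Suc k] = 0 # map Suc [0..<k]"
      by (simp add: upt_conv_Cons map_Suc_upt del: upt_Suc)
    ultimately have "?St holomorphic_on W" by (simp add: o_def v0 del: upt_Suc)
    then have "continuous (at ?zj) ?St"
      using continuous_on_eq_continuous_at[OF opW] zjS(2) holomorphic_on_imp_continuous_on by blast
    then have St_lim: "(?St \<longlongrightarrow> ?St ?zj) (at ?zj)" by (simp only: isCont_def)
    have cf_lim: "((\<lambda>t. cross_factor t (c 0) (v i) (c (Suc i))) \<longlongrightarrow>
        cross_factor ?zj (c 0) (v i) (c (Suc i))) (at ?zj)" if "i < k" for i
      unfolding cross_factor_def using zjS(1) that
      by (intro tendsto_divide tendsto_mult tendsto_diff tendsto_exp tendsto_add tendsto_const tendsto_ident_at)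
         (auto simp: S1_def)
    have pf_lim: "((\<lambda>t. pole_factor t (c 0) (z ! m)) \<longlongrightarrow> pole_factor ?zj (c 0) (z ! m)) (at ?zj)"
      if "m \<in> {..<N} - {j}" for m
      unfolding pole_factor_def using zne[OF j, of m] that
      by (intro tendsto_divide tendsto_diff tendsto_exp tendsto_add tendsto_const tendsto_ident_at) auto
    have R_lim: "(?R \<longlongrightarrow> ?R ?zj) (at ?zj)"
      by (intro tendsto_mult tendsto_divide tendsto_diff tendsto_exp tendsto_add tendsto_const tendsto_prod
          tendsto_ident_at St_lim cf_lim pf_lim e0) auto
    have "((\<lambda>t. (t - ?zj) / (exp t - exp ?zj) * ?R t) \<longlongrightarrow> 1 / exp ?zj * ?R ?zj) (at ?zj)"
      by (intro tendsto_mult exp_diff_quotient_limit R_lim)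
    moreover have "(t - ?zj) / (exp t - exp ?zj) * ?R t = (t - ?zj) * lift_integrand St (Suc k) c z (case_nat t v)" for t
    proof -
      have "(\<Prod>m<N. pole_factor t (c 0) (z ! m)) =
         (exp (t + c 0) - exp ?zj) / (exp t - exp ?zj) * (\<Prod>m\<in>{..<N} - {j}. pole_factor t (c 0) (z ! m))"
        using j by (simp add: prod.remove[of "{..<N}" j] pole_factor_def)
      then show ?thesis unfolding lift_integrand_Suc lz by (simp add: mult_ac)
    qed
    moreover have "1 / exp ?zj * ?R ?zj = shift_coeff (c 0) z j * lift_integrand St k (\<lambda>i. c (Suc i)) ?z' v"
    proof -
      have 1: "?St ?zj = St k (?xs @ ?z') ?ys"
        using vO j zjS(2) by (intro supersymmetric_lift_cancel[OF lift _ _ z(1)]) (auto simp: points_def W_def)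
      have "(\<Prod>m<N. pole_factor (v i) (c (Suc i)) (?z' ! m)) =
         cross_factor ?zj (c 0) (v i) (c (Suc i)) * (\<Prod>m<N. pole_factor (v i) (c (Suc i)) (z ! m))" if "i < k" for i
      proof -
        have "exp (v i) \<noteq> exp ?zj" "exp (v i + c (Suc i)) \<noteq> exp ?zj"
          using vz[OF that j] zjS(1) that by (auto simp: S1_def)
        note cf = cross_factor_mult_pole_factor[OF this, of "c 0"]
        have "(\<Prod>m<N. pole_factor (v i) (c (Suc i)) (?z' ! m)) = pole_factor (v i) (c (Suc i)) (?zj + c 0) *
           (\<Prod>m\<in>{..<N} - {j}. pole_factor (v i) (c (Suc i)) (z ! m))"
          using j lz by (simp add: prod.remove[of "{..<N}" j])
        also have "\<dots> = cross_factor ?zj (c 0) (v i) (c (Suc i)) * (\<Prod>m<N. pole_factor (v i) (c (Suc i)) (z ! m))"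
          using j by (simp add: cf[symmetric] prod.remove[of "{..<N}" j] mult_ac)
        finally show ?thesis .
      qed
      then have 2: "(\<Prod>i<k. (\<Prod>m<N. pole_factor (v i) (c (Suc i)) (?z' ! m)) / (exp (c (Suc i)) - 1)) =
         (\<Prod>i<k. cross_factor ?zj (c 0) (v i) (c (Suc i))) * ?P"
        unfolding prod.distrib[symmetric] by (intro prod.cong) auto
      \<comment> \<open>This quotient cancels the residue 1 / exp z_j of 1 / (exp t - exp
        z_j).\<close>
      have 3: "(exp (?zj + c 0) - exp ?zj) / (exp (c 0) - 1) = exp ?zj"
        using e0 by (simp add: exp_add field_simps)
      have 4: "(\<Prod>m\<in>{..<N} - {j}. pole_factor ?zj (c 0) (z ! m)) = shift_coeff (c 0) z j"
        by (simp add: shift_coeff_def pole_factor_def lz)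
      have "1 / exp ?zj * ?R ?zj = ?St ?zj * (\<Prod>i<k. cross_factor ?zj (c 0) (v i) (c (Suc i))) * ?C *
         (shift_coeff (c 0) z j * ?P) * (1 / exp ?zj * ((exp (?zj + c 0) - exp ?zj) / (exp (c 0) - 1)))"
        unfolding 4 by simp
      also have "\<dots> = ?St ?zj * (\<Prod>i<k. cross_factor ?zj (c 0) (v i) (c (Suc i))) * ?C *
         (shift_coeff (c 0) z j * ?P)" unfolding 3 by simp
      also have "\<dots> = shift_coeff (c 0) z j * lift_integrand St k (\<lambda>i. c (Suc i)) ?z' v"
        unfolding lift_integrand_def 1 length_list_update lz 2 by (simp only: mult_ac)
      finally show ?thesis .
    qed
    ultimately show ?thesis by simp
  qed
  have dist: "distinct z" using z(2) by (auto simp: exp_distinct_def distinct_map)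
  \<comment> \<open>Residues indexed by the point instead of its position, as the sum over
    \<open>set z\<close> requires.\<close>
  define r where "r = (\<lambda>x. Lim (at x) (\<lambda>t. (t - x) * lift_integrand St (Suc k) c z (case_nat t v)))"
  have r: "r (z ! j) = shift_coeff (c 0) z j * lift_integrand St k (\<lambda>i. c (Suc i)) (z[j := z ! j + c 0]) v"
    if "j < N" for j unfolding r_def by (rule tendsto_Lim[OF _ lim[OF that]]) simp
  have "contour_integral ?g (\<lambda>t. lift_integrand St (Suc k) c z (case_nat t v)) =
     2 * of_real pi * \<i> * (\<Sum>x\<in>set z. winding_number ?g x * r x)"
  proof (rule contour_integral_simple_poles[OF _ _ opS1 hol])
    show "set z \<subseteq> S1" using zS1 lz by (auto simp: in_set_conv_nth)
    show "((\<lambda>t. (t - x) * lift_integrand St (Suc k) c z (case_nat t v)) \<longlongrightarrow> r x) (at x)" if "x \<in> set z" for x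
      using that lim r lz by (auto simp: in_set_conv_nth)
    have "t \<notin> set z" if "t \<in> path_image ?g" for t
      using zpole[of 0 t] that lz by (metis in_set_conv_nth zero_less_Suc)
    then show "path_image ?g \<subseteq> S1 - set z" using pS1 by blast
  qed (use wnS1 D(4,10)[of 0] in auto)
  also have "(\<Sum>x\<in>set z. winding_number ?g x * r x) = (\<Sum>x\<in>set z. r x)"
    using I(3)[of 0] zin lz by (intro sum.cong) (auto simp: in_set_conv_nth)
  also have "\<dots> = (\<Sum>j<N. r (z ! j))"
    using dist lz by (subst sum.reindex_bij_betw[OF bij_betw_nth, symmetric]) auto
  finally show ?thesis using r by simp
qed

text \<open>Membership of all translated points in \<open>\<Omega>\<close>^N is proved along with
  the formula: it follows from the same nesting and allows the expectation to be inserted for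
  \<open>S\<close>. The starting point \<open>u\<close> is arbitrary because it changes when the
  variables are renumbered.\<close>

lemma icint_lift_integrand:
  assumes lift: "supersymmetric_lift \<Omega> N S St" and "open \<Omega>"
    and "admissible_contours \<Omega> k c \<gamma>" "z \<in> points \<Omega> N" "\<forall>x\<in>set z. admissible_point k \<gamma> x"
    and "shift_all k c exp_distinct z"
  shows "icint \<gamma> k (lift_integrand St k c z) u = (2 * of_real pi * \<i>) ^ k * shift_op k c S z \<and>
    shift_all k c (\<lambda>z. z \<in> points \<Omega> N) z"
  using assms(3-)
proof (induction k arbitrary: c \<gamma> z u)
  case 0
  then show ?case using lift by (simp add: lift_integrand_def supersymmetric_lift_def)
next
  case (Suc k)
  let ?c = "\<lambda>i. c (Suc i)" and ?\<gamma> = "\<lambda>i. \<gamma> (Suc i)" and ?z = "\<lambda>j. z[j := z ! j + c 0]"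
  note adm = Suc.prems(1)
  have lz: "length z = N" using Suc.prems(2) by (simp add: points_def)
  have adm': "admissible_contours \<Omega> k ?c ?\<gamma>" by (rule admissible_contours_Suc[OF adm])
  note D' = admissible_contoursD[OF adm']
  have pz: "?z j \<in> points \<Omega> N" if "j < N" for j
  proof (rule points_list_update[OF Suc.prems(2)])
    have "z ! j \<in> inside (path_image (\<gamma> 0))"
      using Suc.prems(3) that lz by (auto simp: admissible_point_def)
    then show "z ! j + c 0 \<in> \<Omega>" using admissible_contours_inside(2)[OF adm, of 0] by simp
  qed
  have az: "\<forall>x\<in>set (?z j). admissible_point k ?\<gamma> x" if "j < N" for j
  proof
    fix x assume "x \<in> set (?z j)"
    then consider "x = z ! j + c 0" | "x \<in> set z"
      using set_update_subset_insert[of z j "z ! j + c 0"] by blast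
    then show "admissible_point k ?\<gamma> x"
      using Suc.prems(3) that lz admissible_point_shift[OF adm] admissible_point_Suc
      by cases auto
  qed
  have sz: "shift_all k ?c exp_distinct (?z j)" if "j < N" for j
    using Suc.prems(4) that lz by simp
  have IH: "icint ?\<gamma> k (lift_integrand St k ?c (?z j)) u = (2 * of_real pi * \<i>) ^ k * shift_op k ?c S (?z j)"
    "shift_all k ?c (\<lambda>z. z \<in> points \<Omega> N) (?z j)" if "j < N" for j u
    using Suc.IH[OF adm' pz[OF that] az[OF that] sz[OF that]] by blast+
  have "\<exists>U. (\<forall>i<k. open (U i) \<and> path_image (?\<gamma> i) \<subseteq> U i) \<and> (\<forall>i\<ge>k. U i = UNIV) \<and>
      separately_holomorphic U k (lift_integrand St k ?c (?z j))" if j: "j < N" for j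
  proof (rule lift_integrand_separately_holomorphic_fixed[OF lift \<open>open \<Omega>\<close> pz[OF j] adm'], intro allI impI ballI)
    fix i u m assume *: "i < k" "u \<in> path_image (?\<gamma> i)" "m < N"
    then have "admissible_point k ?\<gamma> (?z j ! m)" using az[OF j] lz by simp
    then show "exp u \<noteq> exp (?z j ! m)" using *(1,2) unfolding admissible_point_def by blast
  qed
  then obtain U where U: "\<And>j. j < N \<Longrightarrow> (\<forall>i<k. open (U j i) \<and> path_image (?\<gamma> i) \<subseteq> U j i) \<and>
      (\<forall>i\<ge>k. U j i = UNIV) \<and> separately_holomorphic (U j) k (lift_integrand St k ?c (?z j))"
    by metis
  have U1: "open (U j i)" and U2: "path_image (?\<gamma> i) \<subseteq> U j i" if "j < N" "i < k" for i j
    using U[OF that(1)] that(2) by simp_all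
  have U3: "U j i = UNIV" if "j < N" "k \<le> i" for i j using U[OF that(1)] that(2) by simp
  have U4: "separately_holomorphic (U j) k (lift_integrand St k ?c (?z j))" if "j < N" for j
    using U[OF that] by simp
  \<comment> \<open>A common domain for all N terms, as linearity of the iterated integral
    requires.\<close>
  define V where "V = (\<lambda>i. \<Inter>j\<in>{..<N}. U j i)"
  \<comment> \<open>Coordinates below \<open>k\<close> are overwritten by the integration; a point
    of the contour is chosen so that \<open>w\<close> lies in the domain.\<close>
  define w where "w = (\<lambda>i. if i < k then pathstart (?\<gamma> i) else u (Suc i))"
  have V: "open (V i)" "path_image (?\<gamma> i) \<subseteq> V i" if "i < k" for i
  proof -
    show "open (V i)" unfolding V_def using U1 that by (intro open_INT) auto
    show "path_image (?\<gamma> i) \<subseteq> V i" unfolding V_def using U2 that by (intro INT_greatest) simp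
  qed
  have w: "w \<in> Pi UNIV V"
  proof (intro Pi_I)
    fix i show "w i \<in> V i"
    proof (cases "i < k")
      case True
      then show ?thesis using V(2)[OF True] pathstart_in_path_image[of "\<gamma> (Suc i)"] by (auto simp: w_def)
    next
      case False
      then show ?thesis using U3 by (simp add: V_def)
    qed
  qed
  have sep: "separately_holomorphic V k (lift_integrand St k ?c (?z j))" if "j \<in> {..<N}" for j
    using that by (intro separately_holomorphic_subset[OF U4]) (auto simp: V_def)
  let ?a = "\<lambda>j. 2 * of_real pi * \<i> * shift_coeff (c 0) z j"
  have "icint \<gamma> (Suc k) (lift_integrand St (Suc k) c z) u =
     icint ?\<gamma> k (\<lambda>v. \<Sum>j<N. ?a j * lift_integrand St k ?c (?z j) v) w"
    unfolding icint_Suc_inner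
  proof (rule icint_cong)
    fix v v' :: "nat \<Rightarrow> complex"
    assume v: "\<And>i. i < k \<Longrightarrow> v i \<in> path_image (?\<gamma> i)" and v': "\<And>i. i < k \<Longrightarrow> v' i = v i"
      "\<And>i. k \<le> i \<Longrightarrow> v i = u (Suc i)" "\<And>i. k \<le> i \<Longrightarrow> v' i = w i"
    have "v' = v"
    proof
      fix i show "v' i = v i" using v' by (cases "i < k") (auto simp: w_def)
    qed
    moreover have "exp_distinct z" using Suc.prems(4) by simp
    ultimately show "contour_integral (\<gamma> 0) (\<lambda>t. lift_integrand St (Suc k) c z (case_nat t v)) =
       (\<Sum>j<N. ?a j * lift_integrand St k ?c (?z j) v')"
      using Suc.prems(3) v
      by (subst residue_step[OF lift \<open>open \<Omega>\<close> adm Suc.prems(2)])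
         (auto simp: sum_distrib_left mult.assoc)
  qed
  also have "\<dots> = (\<Sum>j<N. ?a j * icint ?\<gamma> k (lift_integrand St k ?c (?z j)) w)"
    using sep V D'(10) w by (intro icint_sum[where U = V and k = k]) auto
  also have "\<dots> = (2 * of_real pi * \<i>) ^ Suc k * shift_op (Suc k) c S z"
    using IH(1) lz by (simp add: sum_distrib_left mult_ac)
  finally show ?case using IH(2) Suc.prems(2) lz by simp
qed

text \<open>There are infinitely many periods, yet one radius serves them all: the image of a
  contour under exp is compact and misses 1, so every translate by a period of a small disc around 0
  misses the contour, and the winding number is constant on it.\<close>

lemma eventually_admissible_point:
  assumes adm: "admissible_contours \<Omega> k c \<gamma>" and "open \<Omega>" "0 \<in> \<Omega>"
    and cont_exp: "\<And>i u. i < k \<Longrightarrow> u \<in> path_image (\<gamma> i) \<Longrightarrow> exp u \<noteq> 1"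
    and per: "\<And>i s. i < k \<Longrightarrow> exp s = 1 \<Longrightarrow> s \<noteq> 0 \<Longrightarrow> winding_number (\<gamma> i) s = 0"
  shows "\<forall>\<^sub>F x in nhds 0. x \<in> \<Omega> \<and> admissible_point k \<gamma> x"
proof -
  note D = admissible_contoursD[OF adm]
  have "\<forall>\<^sub>F x in nhds 0. x \<in> inside (path_image (\<gamma> i)) \<and>
     (\<forall>t. exp t = exp x \<longrightarrow> t \<notin> path_image (\<gamma> i) \<and> (t \<noteq> x \<longrightarrow> winding_number (\<gamma> i) t = 0))"
    if i: "i < k" for i
  proof -
    define X where "X = exp -` (- (exp ` path_image (\<gamma> i)))"
    have "compact (exp ` path_image (\<gamma> i))"
      using D(2)[OF i] by (intro compact_continuous_image compact_path_image continuous_intros)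
    then have "open X"
      unfolding X_def by (intro open_vimage) (auto intro: continuous_intros compact_imp_closed)
    moreover have "0 \<in> X" using cont_exp[OF i] by (auto simp: X_def)
    ultimately obtain r where r: "r > 0" "ball 0 r \<subseteq> X" using open_contains_ball by blast
    have main: "x + s \<notin> path_image (\<gamma> i) \<and> winding_number (\<gamma> i) (x + s) = winding_number (\<gamma> i) s"
      if x: "x \<in> ball 0 r" and s: "exp s = 1" for x s
    proof -
      let ?B = "(\<lambda>x. x + s) ` ball 0 r"
      have disj: "?B \<inter> path_image (\<gamma> i) = {}"
      proof -
        have "y + s \<notin> path_image (\<gamma> i)" if "y \<in> ball 0 r" for y
        proof
          assume "y + s \<in> path_image (\<gamma> i)"
          then have "exp (y + s) \<in> exp ` path_image (\<gamma> i)" by (rule imageI)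
          then show False using r(2) that s by (auto simp: X_def exp_add)
        qed
        then show ?thesis by blast
      qed
      have "connected ?B" by (intro connected_continuous_image continuous_intros) simp
      then have "winding_number (\<gamma> i) constant_on ?B"
        using D(2,4)[OF i] disj by (intro winding_number_constant) auto
      moreover have "x + s \<in> ?B" "s \<in> ?B" using x r(1) by (auto simp: image_iff intro!: bexI[of _ 0])
      ultimately show ?thesis using disj unfolding constant_on_def by (metis disjoint_iff)
    qed
    have wn0: "winding_number (\<gamma> i) 0 = 1"
      using adm i by (simp add: admissible_contours_def pos_contour_around0_def)
    have "x \<in> inside (path_image (\<gamma> i)) \<and>
     (\<forall>t. exp t = exp x \<longrightarrow> t \<notin> path_image (\<gamma> i) \<and> (t \<noteq> x \<longrightarrow> winding_number (\<gamma> i) t = 0))"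
      if x: "x \<in> ball 0 r" for x
    proof (intro conjI allI impI)
      show "x \<in> inside (path_image (\<gamma> i))"
        using main[OF x, of 0] wn0 D(3,4)[OF i] by (simp add: inside_simple_closed_path_iff)
      fix t assume "exp t = exp x"
      then have s: "exp (t - x) = 1" by (simp add: exp_diff)
      show "t \<notin> path_image (\<gamma> i)" "t \<noteq> x \<Longrightarrow> winding_number (\<gamma> i) t = 0"
        using main[OF x s] per[OF i s] by auto
    qed
    moreover have "\<forall>\<^sub>F x in nhds 0. x \<in> ball 0 r" using r(1) by (intro eventually_nhds_in_open) auto
    ultimately show ?thesis by (auto elim: eventually_mono)
  qed
  then have "\<forall>\<^sub>F x in nhds 0. \<forall>i\<in>{..<k}. x \<in> inside (path_image (\<gamma> i)) \<and>
     (\<forall>t. exp t = exp x \<longrightarrow> t \<notin> path_image (\<gamma> i) \<and> (t \<noteq> x \<longrightarrow> winding_number (\<gamma> i) t = 0))"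
    by (intro eventually_ball_finite ballI) auto
  moreover have "\<forall>\<^sub>F x in nhds 0. x \<in> \<Omega>"
    using assms by (intro eventually_nhds_in_open)
  ultimately show ?thesis
    by eventually_elim (simp add: admissible_point_def)
qed

text \<open>\<open>s\<close> collects the translations already made, which makes the statement
  stable under induction. If exp (s_i - s_j) is not 1, distinctness holds for small e by continuity;
  otherwise exp (e (a_i - a_j)) is a positive real different from 1.\<close>

lemma eventually_shift_all_exp_distinct:
  fixes a :: "nat \<Rightarrow> real" and s :: "nat \<Rightarrow> complex"
  assumes inj: "\<And>i j. i < N \<Longrightarrow> j < N \<Longrightarrow> i \<noteq> j \<Longrightarrow> a i \<noteq> a j"
  shows "\<forall>\<^sub>F e in at_right 0. shift_all k c exp_distinct (map (\<lambda>i. of_real e * of_real (a i) + s i) [0..<N])"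
proof (induction k arbitrary: c s)
  have dist: "\<forall>\<^sub>F e in at_right 0. exp_distinct (map (\<lambda>i. of_real e * of_real (a i) + s i) [0..<N])" for s
  proof -
    have "\<forall>\<^sub>F e in at_right 0. i \<noteq> j \<longrightarrow>
      exp (of_real e * of_real (a i) + s i) \<noteq> exp (of_real e * of_real (a j) + s j)" if ij: "i < N" "j < N" for i j
    proof (cases "i = j")
      case False
      let ?f = "\<lambda>e. exp (of_real (e * (a i - a j)) + (s i - s j))"
      have "\<forall>\<^sub>F e in at_right 0. ?f e \<noteq> 1"
      proof (cases "exp (s i - s j) = 1")
        case True
        have "?f e \<noteq> 1" if "e > 0" for e
        proof
          assume "?f e = 1"
          then have "of_real (exp (e * (a i - a j))) = (1::complex)"
            using True unfolding exp_add by (simp only: exp_of_real mult_1_right)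
          then have "e * (a i - a j) = 0" by (simp only: of_real_eq_1_iff exp_eq_one_iff)
          then show False using that inj[OF ij False] by simp
        qed
        then show ?thesis
          using eventually_at_right_less[of 0] by (auto elim: eventually_mono)
      next
        case ne: False
        have "(?f \<longlongrightarrow> exp (of_real (0 * (a i - a j)) + (s i - s j))) (at_right 0)"
          by (intro tendsto_intros)
        then have "(?f \<longlongrightarrow> exp (s i - s j)) (at_right 0)" by simp
        then show ?thesis using ne by (rule tendsto_imp_eventually_ne)
      qed
      then show ?thesis
      proof eventually_elim
        case (elim e)
        show ?case
        proof (intro impI notI)
          assume "exp (of_real e * of_real (a i) + s i) = exp (of_real e * of_real (a j) + s j)"
          then have "exp ((of_real e * of_real (a i) + s i) - (of_real e * of_real (a j) + s j)) = (1::complex)"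
            by (simp add: exp_diff)
          then show False using elim by (simp add: algebra_simps)
        qed
      qed
    qed auto
    then have "\<forall>\<^sub>F e in at_right 0. \<forall>i\<in>{..<N}. \<forall>j\<in>{..<N}. i \<noteq> j \<longrightarrow>
      exp (of_real e * of_real (a i) + s i) \<noteq> exp (of_real e * of_real (a j) + s j)"
      by (intro eventually_ball_finite ballI) auto
    then show ?thesis by eventually_elim (simp add: exp_distinct_iff)
  qed
  case 0
  show ?case using dist by simp
next
  case (Suc k)
  have "\<forall>\<^sub>F e in at_right 0. \<forall>j\<in>{..<N}. shift_all k (\<lambda>i. c (Suc i)) exp_distinct
     (map (\<lambda>i. of_real e * of_real (a i) + (s(j := s j + c 0)) i) [0..<N])"
    using Suc by (intro eventually_ball_finite ballI) auto
  moreover have "\<forall>\<^sub>F e in at_right 0. shift_all k c exp_distinct (map (\<lambda>i. of_real e * of_real (a i) + s i) [0..<N])"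
    by (rule Suc)
  ultimately show ?case
  proof eventually_elim
    case (elim e)
    let ?z = "map (\<lambda>i. of_real e * of_real (a i) + s i) [0..<N]"
    have "?z[j := ?z ! j + c 0] = map (\<lambda>i. of_real e * of_real (a i) + (s(j := s j + c 0)) i) [0..<N]"
      if "j < N" for j
      using that by (intro nth_equalityI) (auto simp: nth_list_update)
    then show ?case using elim by (auto dest: shift_all_base)
  qed
qed

text \<open>Since the denominators are 2 pi i-periodic, enclosing a pole is supplemented by
  conditions on its translates by periods; \<open>avoid\<close> and \<open>cont_exp\<close> keep the
  denominators from vanishing on the contours. The starting point of \<open>icint\<close> is
  immaterial, as all k coordinates are overwritten.\<close>

theorem theorem1p6:
  fixes N k :: nat and \<Omega> :: "complex set" and p :: "int list pmf"
    and S :: "complex list \<Rightarrow> complex"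
    and St :: "nat \<Rightarrow> complex list \<Rightarrow> complex list \<Rightarrow> complex"
    and c :: "nat \<Rightarrow> complex" and \<gamma> :: "nat \<Rightarrow> real \<Rightarrow> complex"
  assumes dom: "open \<Omega>" "connected \<Omega>" "0 \<in> \<Omega>"
    and supp: "set_pmf p \<subseteq> signatures N"
    and S_def: "\<And>z. z \<in> points \<Omega> N \<Longrightarrow> exp_distinct z \<Longrightarrow>
                  integrable (measure_pmf p) (\<lambda>l. schur_ratio N l z) \<and>
                  S z = measure_pmf.expectation p (\<lambda>l. schur_ratio N l z)"
    and unif: "\<exists>r>0. \<forall>e>0. \<exists>F. finite F \<and>
                 (\<forall>z\<in>points (ball 0 r) N. exp_distinct z \<longrightarrow>
                    (\<lambda>l. pmf p l * norm (schur_ratio N l z)) summable_on (- F) \<and>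
                    (\<Sum>\<^sub>\<infinity>l\<in>- F. pmf p l * norm (schur_ratio N l z)) < e)"
    and S_an: "analytic_lists \<Omega> N S" and S_sym: "symmetric_on \<Omega> N S"
    and lift: "supersymmetric_lift \<Omega> N S St"
    and c_nz: "\<And>i. i < k \<Longrightarrow> exp (c i) \<noteq> 1"
    and cont: "\<And>i. i < k \<Longrightarrow> pos_contour_around0 \<Omega> (\<gamma> i)"
    and cont_tr: "\<And>i. i < k \<Longrightarrow> pos_contour_around0 \<Omega> (\<lambda>t. \<gamma> i t + c i)"
    and cont_per: "\<And>i m. i < k \<Longrightarrow> m \<noteq> 0 \<Longrightarrow>
                     winding_number (\<gamma> i) (2 * pi * \<i> * of_int m) = 0"
    and cont_exp: "\<And>i u. i < k \<Longrightarrow> u \<in> path_image (\<gamma> i) \<Longrightarrow> exp u \<noteq> 1"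
    and nest: "\<And>i j u. i < j \<Longrightarrow> j < k \<Longrightarrow> u \<in> path_image (\<gamma> i) \<Longrightarrow>
                 u + c i \<notin> path_image (\<gamma> j) \<and> winding_number (\<gamma> j) (u + c i) = 1"
    and nest_per: "\<And>i j u m. i < j \<Longrightarrow> j < k \<Longrightarrow> u \<in> path_image (\<gamma> i) \<Longrightarrow> m \<noteq> 0 \<Longrightarrow>
                 winding_number (\<gamma> j) (u + c i + 2 * pi * \<i> * of_int m) = 0"
    and avoid: "\<And>i j u v. i < j \<Longrightarrow> j < k \<Longrightarrow> u \<in> path_image (\<gamma> i) \<Longrightarrow>
                 v \<in> path_image (\<gamma> j) \<Longrightarrow> exp v \<noteq> exp (u + c i) \<and> exp (v + c j) \<noteq> exp u"
  shows "integrable (measure_pmf p)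
           (\<lambda>l. \<Prod>i<k. \<Sum>j<N. exp (c i * of_int (l ! j + int N - 1 - int j))) \<and>
         measure_pmf.expectation p
           (\<lambda>l. \<Prod>i<k. \<Sum>j<N. exp (c i * of_int (l ! j + int N - 1 - int j)))
         = icint \<gamma> k
             (\<lambda>u. St k (map (\<lambda>i. u i + c i) [0..<k] @ replicate N 0) (map u [0..<k]) *
                  (\<Prod>i<k. \<Prod>j\<in>{i<..<k}.
                     ((exp (u j + c j) - exp (u i + c i)) * (exp (u j) - exp (u i))) /
                     ((exp (u j) - exp (u i + c i)) * (exp (u j + c j) - exp (u i)))) *
                  (\<Prod>i<k. ((exp (u i + c i) - 1) / (exp (u i) - 1)) ^ N / (exp (c i) - 1)))
             (\<lambda>_. 0)
           / (2 * pi * \<i>) ^ k"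
proof -
  let ?cp = "central_point N"
  define Q where "Q = (\<lambda>l. \<Prod>i<k. \<Sum>j<N. exp (c i * of_int (l ! j + int N - 1 - int j)))"
  define J where "J = (\<lambda>z. icint \<gamma> k (lift_integrand St k c z) (\<lambda>_. 0))"
  have per_eq: "\<exists>m::int. m \<noteq> 0 \<and> s = 2 * pi * \<i> * of_int m" if "exp s = 1" "s \<noteq> 0" for s :: complex
  proof -
    have "exp s = exp 0" using that(1) by simp
    then obtain m :: int where "s = 0 + (of_int (2 * m) * pi) * \<i>"
      unfolding exp_eq by blast
    then show ?thesis using that(2) by (intro exI[of _ m]) auto
  qed

  \<comment> \<open>Admissibility of the contours and of small central points\<close>
  have adm: "admissible_contours \<Omega> k c \<gamma>"
    unfolding admissible_contours_def
  proof (rule conjI; intro allI impI conjI ballI)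
    fix i j assume ij: "i < j" "j < k"
    have j: "simple_path (\<gamma> j)" "pathfinish (\<gamma> j) = pathstart (\<gamma> j)"
      using cont[OF ij(2)] by (auto simp: pos_contour_around0_def)
    show "path_image (\<lambda>t. \<gamma> i t + c i) \<subseteq> inside (path_image (\<gamma> j))"
      using nest[OF ij] j by (auto simp: path_image_translate inside_simple_closed_path_iff)
    fix u assume u: "u \<in> path_image (\<gamma> i)"
    show "winding_number (\<gamma> j) (u + c i + s) = 0" if s: "exp s = 1" "s \<noteq> 0" for s
      using per_eq[OF s] nest_per[OF ij u] by auto
  qed (use c_nz cont cont_tr avoid in auto)
  note D = admissible_contoursD[OF adm]
  have per0: "winding_number (\<gamma> i) s = 0" if "i < k" "exp s = 1" "s \<noteq> 0" for i s
    using per_eq[OF that(2,3)] cont_per[OF that(1)] by auto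
  have ev0: "\<forall>\<^sub>F x in nhds 0. x \<in> \<Omega> \<and> admissible_point k \<gamma> x"
    using per0 cont_exp dom by (intro eventually_admissible_point[OF adm]) auto
  have cp: "?cp e = map (\<lambda>i. of_real e * of_real ((real N - 1) / 2 - real i) + 0) [0..<N]" for e
    by (simp add: central_point_def)
  have lcp: "length (?cp e) = N" for e by (simp add: central_point_def)
  have "\<forall>\<^sub>F e in at_right 0. \<forall>x\<in>set (?cp e). x \<in> \<Omega> \<and> admissible_point k \<gamma> x"
  proof -
    have "\<forall>\<^sub>F e in at_right 0. \<forall>i\<in>{..<N}. of_real e * of_real ((real N - 1) / 2 - real i) \<in> \<Omega> \<and>
        admissible_point k \<gamma> (of_real e * of_real ((real N - 1) / 2 - real i))"
    proof (intro eventually_ball_finite ballI)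
      fix i :: nat
      have "((\<lambda>e. of_real e * of_real ((real N - 1) / 2 - real i)) \<longlongrightarrow>
          complex_of_real 0 * of_real ((real N - 1) / 2 - real i)) (at_right 0)"
        by (intro tendsto_intros)
      then have lim0: "((\<lambda>e. complex_of_real e * of_real ((real N - 1) / 2 - real i)) \<longlongrightarrow> 0) (at_right 0)"
        by (simp only: of_real_0 mult_zero_left)
      show "\<forall>\<^sub>F e in at_right 0. of_real e * of_real ((real N - 1) / 2 - real i) \<in> \<Omega> \<and>
          admissible_point k \<gamma> (of_real e * of_real ((real N - 1) / 2 - real i))"
        by (rule eventually_compose_filterlim[OF ev0 lim0])
    qed simp
    then show ?thesis by eventually_elim (auto simp: cp simp del: of_real_diff)
  qed
  moreover have "\<forall>\<^sub>F e in at_right 0. shift_all k c exp_distinct (?cp e)"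
    unfolding cp by (rule eventually_shift_all_exp_distinct) auto
  ultimately have "\<forall>\<^sub>F e in at_right 0. (\<forall>x\<in>set (?cp e). x \<in> \<Omega> \<and> admissible_point k \<gamma> x) \<and>
      shift_all k c exp_distinct (?cp e)"
    by eventually_elim simp
  then obtain b where b: "b > 0" "\<And>e. 0 < e \<Longrightarrow> e < b \<Longrightarrow>
      (\<forall>x\<in>set (?cp e). x \<in> \<Omega> \<and> admissible_point k \<gamma> x) \<and> shift_all k c exp_distinct (?cp e)"
    unfolding eventually_at_right_field by blast
  \<comment> \<open>Strictly below \<open>b\<close>, so that \<open>e0\<close> itself is a good
    parameter; it supplies the dominating function.\<close>
  define e0 where "e0 = b / 2"
  have e0: "e0 > 0" using b(1) by (simp add: e0_def)
  have main: "integrable (measure_pmf p) (\<lambda>l. Q l * schur_ratio N l (?cp e)) \<and>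
      J (?cp e) = (2 * pi * \<i>) ^ k * measure_pmf.expectation p (\<lambda>l. Q l * schur_ratio N l (?cp e))"
    if e: "0 < e" "e \<le> e0" for e
  proof -
    have be: "\<forall>x\<in>set (?cp e). x \<in> \<Omega> \<and> admissible_point k \<gamma> x" "shift_all k c exp_distinct (?cp e)"
      using b(2)[of e] e b(1) by (auto simp: e0_def)
    have pts: "?cp e \<in> points \<Omega> N" using be(1) lcp by (auto simp: points_def)
    have 1: "J (?cp e) = (2 * of_real pi * \<i>) ^ k * shift_op k c S (?cp e)"
      "shift_all k c (\<lambda>z. z \<in> points \<Omega> N) (?cp e)"
      unfolding J_def using icint_lift_integrand[OF lift dom(1) adm pts _ be(2)] be(1) by auto
    have 2: "integrable (measure_pmf p) (\<lambda>l. shift_op k c (schur_ratio N l) (?cp e)) \<and>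
      shift_op k c S (?cp e) = measure_pmf.expectation p (\<lambda>l. shift_op k c (schur_ratio N l) (?cp e))"
      using S_def by (intro shift_op_expectation[OF _ shift_all_conj[OF be(2) 1(2)]]) auto
    have "shift_op k c (schur_ratio N l) (?cp e) = Q l * schur_ratio N l (?cp e)" for l
      unfolding shift_op_schur_ratio[OF be(2)] lcp Q_def shifted_part_def ..
    then show ?thesis using 1(1) 2 by simp
  qed

  \<comment> \<open>Integrability of the moment and the limit of the expectations\<close>
  have lsig: "l \<in> signatures N" if "l \<in> set_pmf p" for l using supp that by blast
  have intQ: "integrable (measure_pmf p) Q"
  proof (rule Bochner_Integration.integrable_bound)
    show "integrable (measure_pmf p) (\<lambda>l. Q l * schur_ratio N l (?cp e0))" using main[of e0] e0 by simp
    show "AE l in measure_pmf p. norm (Q l) \<le> norm (Q l * schur_ratio N l (?cp e0))"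
      unfolding AE_measure_pmf_iff norm_mult
      using norm_schur_ratio_central_point_ge_1[OF lsig e0] by (intro ballI) (metis mult.right_neutral mult_left_mono norm_ge_zero)
  qed simp
  define en where "en = (\<lambda>n::nat. e0 / (real n + 1))"
  have en: "0 < en n" "en n \<le> e0" for n
    using e0 by (auto simp: en_def field_simps)
  have en0: "en \<longlonglongrightarrow> 0"
    unfolding en_def using LIMSEQ_Suc[OF lim_const_over_n[of e0]] by (simp add: add.commute)
  have limE: "(\<lambda>n. measure_pmf.expectation p (\<lambda>l. Q l * schur_ratio N l (?cp (en n)))) \<longlonglongrightarrow>
      measure_pmf.expectation p Q"
  proof (rule integral_dominated_convergence)
    let ?C = "\<Prod>i<N. \<Prod>j\<in>{i<..<N}. sinh (e0 * ((real j - real i) / 2)) / (e0 * ((real j - real i) / 2))"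
    show "integrable (measure_pmf p) (\<lambda>l. ?C * norm (Q l * schur_ratio N l (?cp e0)))"
      using main[of e0] e0 by (intro integrable_mult_right integrable_norm) auto
    show "AE l in measure_pmf p. norm (Q l * schur_ratio N l (?cp (en n))) \<le> ?C * norm (Q l * schur_ratio N l (?cp e0))" for n
      unfolding AE_measure_pmf_iff
    proof
      fix l assume "l \<in> set_pmf p"
      from mult_left_mono[OF norm_schur_ratio_central_point_le[OF lsig[OF this] en], of "norm (Q l)"]
      show "norm (Q l * schur_ratio N l (?cp (en n))) \<le> ?C * norm (Q l * schur_ratio N l (?cp e0))"
        by (simp add: norm_mult mult_ac)
    qed
    show "AE l in measure_pmf p. (\<lambda>n. Q l * schur_ratio N l (?cp (en n))) \<longlonglongrightarrow> Q l"
      unfolding AE_measure_pmf_iff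
    proof
      fix l assume l: "l \<in> set_pmf p"
      \<comment> \<open>Otherwise the quotient defining the ratio would have the default value 0,
        against the lower bound 1.\<close>
      have "weyl_dim N l \<noteq> 0"
        using norm_schur_ratio_central_point_ge_1[OF lsig[OF l] e0]
        by (auto simp: schur_ratio_def schur_one_eq_weyl_dim)
      moreover have "filterlim (\<lambda>n. complex_of_real (en n)) (at 0) sequentially"
        using tendsto_of_real[OF en0, where 'a = complex] en(1)
        by (intro filterlim_atI) (auto intro!: always_eventually simp: less_imp_neq[symmetric])
      then have "(\<lambda>n. schur l (map exp (?cp (en n)))) \<longlonglongrightarrow> weyl_dim N l"
        unfolding central_point_def by (rule filterlim_compose[OF schur_geometric_limit])
      ultimately have "(\<lambda>n. Q l * (schur l (map exp (?cp (en n))) / weyl_dim N l)) \<longlonglongrightarrow> Q l * (weyl_dim N l / weyl_dim N l)"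
        by (intro tendsto_intros)
      then show "(\<lambda>n. Q l * schur_ratio N l (?cp (en n))) \<longlonglongrightarrow> Q l"
        using \<open>weyl_dim N l \<noteq> 0\<close> by (simp add: schur_ratio_def schur_one_eq_weyl_dim)
    qed
  qed simp_all

  \<comment> \<open>The limit of the contour integrals\<close>
  have limJ: "(\<lambda>n. J (?cp (en n))) \<longlonglongrightarrow> J (replicate N 0)"
  proof -
    let ?F = "\<lambda>u. lift_integrand St k c (map (\<lambda>m. u (k + m)) [0..<N]) u"
    have "\<exists>U. (\<forall>i<k. open (U i) \<and> path_image (\<gamma> i) \<subseteq> U i) \<and>
      (\<forall>m<N. open (U (k + m)) \<and> replicate N 0 ! m \<in> U (k + m)) \<and> (\<forall>i\<ge>k + N. U i = UNIV) \<and>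
      separately_holomorphic U k ?F"
      using dom cont_exp
      by (intro lift_integrand_separately_holomorphic[OF lift dom(1) _ adm]) (auto simp: points_def)
    then obtain U where U: "\<forall>i<k. open (U i) \<and> path_image (\<gamma> i) \<subseteq> U i"
      "\<forall>m<N. open (U (k + m)) \<and> replicate N 0 ! m \<in> U (k + m)" "\<forall>i\<ge>k + N. U i = UNIV"
      "separately_holomorphic U k ?F" by (elim exE conjE)
    have "separately_holomorphic U k (icint \<gamma> k ?F)"
      using U D(10) by (intro separately_holomorphic_icint) auto
    then have cont_icint: "continuous_on (Pi UNIV U) (icint \<gamma> k ?F)"
      by (simp add: separately_holomorphic_def)
    \<comment> \<open>A curve that lies in \<open>Pi UNIV U\<close> for e near 0. Coordinates from k
      to k + N - 1 give the central point, which is 0^N at e = 0; those below k are arbitrary values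
      on the contours.\<close>
    define h where "h = (\<lambda>e i. if i < k then pathstart (\<gamma> i) else of_real e * of_real ((real N - 1) / 2 - real (i - k)) :: complex)"
    have hcp: "map (\<lambda>m. h e (k + m)) [0..<N] = ?cp e" for e
      by (simp add: h_def cp)
    have Jh: "icint \<gamma> k ?F (h e) = J (?cp e)" for e
      unfolding J_def
    proof (rule icint_cong)
      fix v v' assume v: "\<And>i. i < k \<Longrightarrow> v' i = v i" "\<And>i. k \<le> i \<Longrightarrow> v i = h e i"
      have "map (\<lambda>m. v (k + m)) [0..<N] = ?cp e" unfolding hcp[symmetric] using v(2) by simp
      moreover have "lift_integrand St k c z v = lift_integrand St k c z v'" for z
        unfolding lift_integrand_def using v(1)
        by (intro arg_cong2[of _ _ _ _ "(*)"] arg_cong2[of _ _ _ _ "St k"] arg_cong2[of _ _ _ _ "(@)"]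
            map_cong prod.cong) auto
      ultimately show "?F v = lift_integrand St k c (?cp e) v'" by simp
    qed
    have "\<forall>\<^sub>F e in nhds (0::real). \<forall>m\<in>{..<N}. h e (k + m) \<in> U (k + m)"
    proof (intro eventually_ball_finite ballI)
      fix m assume m: "m \<in> {..<N}"
      have "((\<lambda>e. of_real e * of_real ((real N - 1) / 2 - real m)) \<longlongrightarrow>
          complex_of_real 0 * of_real ((real N - 1) / 2 - real m)) (nhds 0)"
        by (intro tendsto_intros filterlim_ident)
      then have lim0: "((\<lambda>e. h e (k + m)) \<longlongrightarrow> 0) (nhds 0)"
        by (simp only: of_real_0 mult_zero_left h_def) simp
      have ev: "\<forall>\<^sub>F x in nhds 0. x \<in> U (k + m)"
        using U(2) m by (intro eventually_nhds_in_open) auto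
      show "\<forall>\<^sub>F e in nhds 0. h e (k + m) \<in> U (k + m)"
        by (rule eventually_compose_filterlim[OF ev lim0])
    qed simp
    then obtain r where r: "r > 0" "\<And>e m. e \<in> ball 0 r \<Longrightarrow> m < N \<Longrightarrow> h e (k + m) \<in> U (k + m)"
      unfolding eventually_nhds_metric by (auto simp: dist_commute)
    have hU: "h e \<in> Pi UNIV U" if "e \<in> ball 0 r" for e
    proof (intro Pi_I)
      fix i
      consider "i < k" | "k \<le> i" "i - k < N" | "k + N \<le> i" by linarith
      then show "h e i \<in> U i"
      proof cases
        case 1
        then have "path_image (\<gamma> i) \<subseteq> U i" using U(1) by simp
        then show ?thesis using 1 pathstart_in_path_image[of "\<gamma> i"] by (auto simp: h_def)
      next
        case 2
        then show ?thesis using r(2)[OF that, of "i - k"] by simp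
      next
        case 3
        then show ?thesis using U(3) by simp
      qed
    qed
    have "continuous_on (ball 0 r) h"
    proof (rule continuous_on_coordinatewise_then_product)
      show "continuous_on (ball 0 r) (\<lambda>e. h e i)" for i
        by (cases "i < k") (auto simp: h_def intro!: continuous_intros)
    qed
    then have "continuous_on (ball 0 r) (\<lambda>e. icint \<gamma> k ?F (h e))"
      by (rule continuous_on_compose2[OF cont_icint]) (use hU in blast)
    then have "continuous_on (ball 0 r) (\<lambda>e. J (?cp e))" unfolding Jh .
    then have "isCont (\<lambda>e. J (?cp e)) 0"
      using r(1) by (simp add: continuous_on_eq_continuous_at)
    then have "(\<lambda>n. J (?cp (en n))) \<longlonglongrightarrow> J (?cp 0)"
      by (rule isCont_tendsto_compose[OF _ en0])
    moreover have "?cp 0 = replicate N 0"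
      by (intro nth_equalityI) (auto simp: central_point_def)
    ultimately show ?thesis by simp
  qed
  have "(\<lambda>n. J (?cp (en n))) \<longlonglongrightarrow> (2 * pi * \<i>) ^ k * measure_pmf.expectation p Q"
    using tendsto_mult[OF tendsto_const limE, of "(2 * pi * \<i>) ^ k"] main en by simp
  then have "J (replicate N 0) = (2 * pi * \<i>) ^ k * measure_pmf.expectation p Q"
    using limJ LIMSEQ_unique by blast
  moreover have "lift_integrand St k c (replicate N 0) = (\<lambda>u. St k (map (\<lambda>i. u i + c i) [0..<k] @ replicate N 0) (map u [0..<k]) *
                  (\<Prod>i<k. \<Prod>j\<in>{i<..<k}.
                     ((exp (u j + c j) - exp (u i + c i)) * (exp (u j) - exp (u i))) /
                     ((exp (u j) - exp (u i + c i)) * (exp (u j + c j) - exp (u i)))) *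
                  (\<Prod>i<k. ((exp (u i + c i) - 1) / (exp (u i) - 1)) ^ N / (exp (c i) - 1)))"
    by (auto simp: lift_integrand_def cross_factor_def pole_factor_def fun_eq_iff)
  ultimately show ?thesis
    using intQ unfolding J_def Q_def by (simp del: of_int_diff of_int_add)
qed

end
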